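(* For each $k\in\mathbb{N}$, the Banach space $C(2^{\mathbb{N}})$ contains a $k$-weakly compact subset whose closed, convex hull is not $k$-weakly compact. Furthermore, the topology $\tau_k$ on $C(2^{\mathbb{N}})$ is not locally convex.
   Context: $2^{\mathbb{N}}=\{0,1\}^{\mathbb{N}}$ is the Cantor set with the product topology and $C(2^{\mathbb{N}})$ is the Banach space of continuous $\mathbb{K}$-valued functions on it with the supremum norm, $\mathbb{K}\in\{\mathbb{R},\mathbb{C}\}$. $\mathbb{N}=\{1,2,\ldots\}$. For subsets $E,F$ of $\mathbb{N}$, $E<F$ means $\max E<\min F$. Schreier families of finite order $\mathcal{S}_k$, families of finite subsets of $\mathbb{N}$: $\mathcal{S}_0=\{\varnothing\}\cup\{\{n\}:n\in\mathbb{N}\}$; $\mathcal{S}_{k+1}=\{\varnothing\}\cup\{\bigcup_{i=1}^nE_i: \varnothing\neq E_i\in\mathcal{S}_k,\ E_1<\ldots<E_n,\ n\leqslant\min E_1\}$. For $k\in\mathbb{N}$, a sequence $(x_n)_{n=1}^\infty$ in a Banach space is an $\ell_1^k$-spreading model if $0<\inf\{\|x\|: E\in\mathcal{S}_k,\ x=\sum_{n\in E}a_nx_n,\ \sum_{n\in E}|a_n|=1\}$. A sequence $(x_n)_{n=1}^\infty$ in a Banach space $X$ is $k$-weakly convergent to $x\in X$ if it converges weakly to $x$ and no subsequence of $(x_n-x)_{n=1}^\infty$ is an $\ell_1^k$-spreading model. A set $K\subset X$ is $k$-weakly compact if every sequence in $K$ has a subsequence which is $k$-weakly convergent to some member of $K$.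 A subset $C$ of $X$ is $k$-closed if whenever $(x_n)_{n=1}^\infty\subset C$ is $k$-weakly convergent to $x\in X$, then $x\in C$. A set is $k$-open if its complement is $k$-closed. $\tau_k$ is the collection of all $k$-open subsets of $X$; it is a topology on $X$. Locally convex here means that every point has a neighborhood base consisting of convex sets. *)

theory Defs
  imports "HOL-Analysis.Analysis"
begin

section \<open>Schreier families\<close>

text \<open>The natural numbers here start at 1, so members of the families never contain 0.\<close>

primrec schreier :: "nat \<Rightarrow> nat set set" where
  "schreier 0 = {{}} \<union> {{n} | n. n \<ge> 1}"
| "schreier (Suc k) = {{}} \<union>
     {(\<Union>i\<in>{1..n}. E i) | (n::nat) (E :: nat \<Rightarrow> nat set).
        n \<ge> 1 \<and> (\<forall>i\<in>{1..n}. E i \<noteq> {} \<and> E i \<in> schreier k) \<and>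
        (\<forall>i\<in>{1..n}. \<forall>j\<in>{1..n}. i < j \<longrightarrow> Max (E i) < Min (E j)) \<and>
        n \<le> Min (E 1)}"

lemma schreier_finite_pos: "E \<in> schreier k \<Longrightarrow> finite E \<and> 0 \<notin> E"
  by (induction k arbitrary: E) force+

section \<open>Sequences in normed spaces over the scalar field\<close>

text \<open>
  The library has real normed spaces only. To treat both scalar fields at once, scalar
  multiplication by a field \<open>'k\<close> is passed explicitly as \<open>smul\<close>; it is meant to extend
  \<open>(*\<^sub>R)\<close> and to be homogeneous for the norm (\<open>bcont_scale\<close> below is).

  Sequences \<open>(x\<^sub>n)\<close>, \<open>n \<ge> 1\<close>, are functions on \<^typ>\<open>nat\<close> whose value at 0 is ignored. Since
  \<open>strict_mono r\<close> forces \<open>r n \<ge> n\<close>, the subsequences of such an \<open>x\<close> are exactly the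
  \<open>x \<circ> r\<close> with \<open>r\<close> strictly increasing on \<^typ>\<open>nat\<close>.
\<close>

definition l1_spreading_model ::
    "('k::real_normed_field \<Rightarrow> 'a::real_normed_vector \<Rightarrow> 'a) \<Rightarrow> nat \<Rightarrow> (nat \<Rightarrow> 'a) \<Rightarrow> bool" where
  "l1_spreading_model smul k x \<longleftrightarrow>
     0 < Inf {norm (\<Sum>n\<in>E. smul (a n) (x n)) | E (a :: nat \<Rightarrow> 'k).
                E \<in> schreier k \<and> (\<Sum>n\<in>E. norm (a n)) = 1}"

definition weakly_converges ::
    "('k::real_normed_field \<Rightarrow> 'a::real_normed_vector \<Rightarrow> 'a) \<Rightarrow> (nat \<Rightarrow> 'a) \<Rightarrow> 'a \<Rightarrow> bool" where
  "weakly_converges smul x l \<longleftrightarrow>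
     (\<forall>f :: 'a \<Rightarrow> 'k. bounded_linear f \<and> (\<forall>c v. f (smul c v) = c * f v) \<longrightarrow>
        (\<lambda>n. f (x n)) \<longlonglongrightarrow> f l)"

definition k_weakly_converges ::
    "('k::real_normed_field \<Rightarrow> 'a::real_normed_vector \<Rightarrow> 'a) \<Rightarrow> nat \<Rightarrow> (nat \<Rightarrow> 'a) \<Rightarrow> 'a \<Rightarrow> bool" where
  "k_weakly_converges smul k x l \<longleftrightarrow>
     weakly_converges smul x l \<and>
     \<not> (\<exists>r :: nat \<Rightarrow> nat. strict_mono r \<and> l1_spreading_model smul k (\<lambda>n. x (r n) - l))"

definition k_weakly_compact ::
    "('k::real_normed_field \<Rightarrow> 'a::real_normed_vector \<Rightarrow> 'a) \<Rightarrow> nat \<Rightarrow> 'a set \<Rightarrow> bool" where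
  "k_weakly_compact smul k K \<longleftrightarrow>
     (\<forall>x. (\<forall>n\<ge>1. x n \<in> K) \<longrightarrow>
        (\<exists>r l. strict_mono (r :: nat \<Rightarrow> nat) \<and> l \<in> K \<and> k_weakly_converges smul k (x \<circ> r) l))"

definition k_closed ::
    "('k::real_normed_field \<Rightarrow> 'a::real_normed_vector \<Rightarrow> 'a) \<Rightarrow> nat \<Rightarrow> 'a set \<Rightarrow> bool" where
  "k_closed smul k C \<longleftrightarrow>
     (\<forall>x l. (\<forall>n\<ge>1. x n \<in> C) \<and> k_weakly_converges smul k x l \<longrightarrow> l \<in> C)"

definition k_open ::
    "('k::real_normed_field \<Rightarrow> 'a::real_normed_vector \<Rightarrow> 'a) \<Rightarrow> nat \<Rightarrow> 'a set \<Rightarrow> bool" where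
  "k_open smul k U \<longleftrightarrow> k_closed smul k (- U)"

definition tau ::
    "('k::real_normed_field \<Rightarrow> 'a::real_normed_vector \<Rightarrow> 'a) \<Rightarrow> nat \<Rightarrow> 'a topology" where
  "tau smul k = topology (k_open smul k)"

lemma k_weakly_converges_subseq:
  assumes "k_weakly_converges smul k x l" and r: "strict_mono (r :: nat \<Rightarrow> nat)"
  shows "k_weakly_converges smul k (x \<circ> r) l"
  unfolding k_weakly_converges_def
proof
  show "weakly_converges smul (x \<circ> r) l"
    using assms LIMSEQ_subseq_LIMSEQ[OF _ r]
    unfolding k_weakly_converges_def weakly_converges_def comp_def by blast
  have "strict_mono (\<lambda>n. r (s n))" if "strict_mono s" for s :: "nat \<Rightarrow> nat"
    using strict_mono_o[OF r that] by (simp add: comp_def)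
  then show "\<not> (\<exists>s. strict_mono s \<and> l1_spreading_model smul k (\<lambda>n. (x \<circ> r) (s n) - l))"
    using assms(1) unfolding k_weakly_converges_def comp_def by blast
qed

lemma k_closed_Un:
  assumes C: "k_closed smul k C" and D: "k_closed smul k D"
  shows "k_closed smul k (C \<union> D)"
  unfolding k_closed_def
proof (intro allI impI)
  fix x l
  assume x: "(\<forall>n\<ge>1. x n \<in> C \<union> D) \<and> k_weakly_converges smul k x l"
  have main: "l \<in> B" if inf: "infinite {n. x n \<in> B}" and B: "k_closed smul k B" for B
  proof -
    obtain r :: "nat \<Rightarrow> nat" where r: "strict_mono r" "\<And>n. r n \<in> {n. x n \<in> B}"
      using infinite_enumerate[OF inf] by blast
    have "k_weakly_converges smul k (x \<circ> r) l"
      using k_weakly_converges_subseq x r(1) by blast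
    moreover have "\<forall>n\<ge>1. (x \<circ> r) n \<in> B"
      using r(2) by simp
    ultimately show ?thesis
      using B unfolding k_closed_def by blast
  qed
  have "{1..} \<subseteq> {n. x n \<in> C} \<union> {n. x n \<in> D}"
    using x by auto
  then have "infinite {n. x n \<in> C} \<or> infinite {n. x n \<in> D}"
    by (meson finite_Un finite_subset infinite_Ici)
  then show "l \<in> C \<union> D"
    using main C D by blast
qed

lemma istopology_k_open: "istopology (k_open smul k)"
  unfolding istopology_def
proof (intro conjI allI impI)
  fix S T assume "k_open smul k S" "k_open smul k T"
  then show "k_open smul k (S \<inter> T)"
    by (simp add: k_open_def k_closed_Un)
next
  fix \<K> assume "\<forall>K\<in>\<K>. k_open smul k K"
  then show "k_open smul k (\<Union>\<K>)"
    unfolding k_open_def k_closed_def by (metis ComplD ComplI UnionE UnionI)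
qed

lemma openin_tau: "openin (tau smul k) U \<longleftrightarrow> k_open smul k U"
  by (simp add: tau_def istopology_k_open)

lemma topspace_tau [simp]: "topspace (tau smul k) = UNIV"
proof -
  have "k_open smul k UNIV"
    by (auto simp: k_open_def k_closed_def)
  then show ?thesis
    by (metis openin_subset openin_tau top.extremum_unique)
qed

section \<open>The Banach space of continuous functions on the Cantor set\<close>

type_synonym cantor = "nat \<Rightarrow> bool"

text \<open>
  \<^typ>\<open>bool\<close> is discrete and \<^typ>\<open>cantor\<close> has the product topology. As it is compact, all
  continuous functions on it are bounded, so \<open>cantor \<Rightarrow>\<^sub>C 'k\<close> is the full space of continuous
  functions with the supremum norm.
\<close>

lemma compact_UNIV_cantor: "compact (UNIV :: cantor set)"
proof -
  have "compact_space (product_topology (\<lambda>_::nat. euclidean :: bool topology) UNIV)"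
    unfolding compact_space_product_topology by (simp add: compact_space_def finite_imp_compact)
  then show ?thesis
    by (simp add: euclidean_product_topology compact_space_def)
qed

lemma continuous_cantor_bcontfun:
  fixes f :: "cantor \<Rightarrow> 'b::metric_space"
  shows "f \<in> bcontfun \<longleftrightarrow> continuous_on UNIV f"
  unfolding bcontfun_def
  using compact_continuous_image[OF _ compact_UNIV_cantor] compact_imp_bounded by blast

definition bcont_scale ::
    "'k::real_normed_field \<Rightarrow> ('a::topological_space \<Rightarrow>\<^sub>C 'k) \<Rightarrow> ('a \<Rightarrow>\<^sub>C 'k)" where
  "bcont_scale c f = Bcontfun (\<lambda>t. c * f t)"

lemma apply_bcont_scale [simp]: "apply_bcontfun (bcont_scale c f) t = c * f t"
proof -
  have "(\<lambda>t. c * f t) \<in> bcontfun"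
  proof (rule bcontfun_normI)
    show "norm (c * f t) \<le> norm c * norm f" for t
      by (simp add: norm_mult mult_left_mono norm_bounded)
  qed (intro continuous_intros continuous_on_apply_bcontfun)
  then show ?thesis
    by (simp add: bcont_scale_def Bcontfun_inverse)
qed

lemma vector_space_bcont_scale: "vector_space bcont_scale"
  by unfold_locales (auto intro!: bcontfun_eqI simp: algebra_simps)

lemma bcont_scale_of_real: "bcont_scale (of_real r) f = r *\<^sub>R f"
  by (rule bcontfun_eqI) (simp add: scaleR_conv_of_real)

lemma norm_bcont_scale: "norm (bcont_scale c f) = norm c * norm f"
proof -
  have le: "norm (bcont_scale c f) \<le> norm c * norm f" for c and f :: "'a \<Rightarrow>\<^sub>C 'b"
    by (rule norm_bound) (simp add: norm_mult mult_left_mono norm_bounded)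
  show ?thesis
  proof (cases "c = 0")
    case True
    then show ?thesis using le[of c f] by simp
  next
    case False
    have "bcont_scale (inverse c) (bcont_scale c f) = f"
      using False by (auto intro!: bcontfun_eqI)
    then have "norm f \<le> inverse (norm c) * norm (bcont_scale c f)"
      using le[of "inverse c" "bcont_scale c f"] by (metis norm_inverse)
    then show ?thesis
      using False le[of c f] by (intro antisym) (simp_all add: field_simps)
  qed
qed

end

theory Submission
  imports Defs "HOL-Library.Ramsey"
begin

text \<open>
  Points of the Cantor set are read as subsets \<open>t\<close> of the natural numbers. For a colouring \<open>c\<close>
  of pairs of numbers up to \<open>n\<close>, let \<open>basic k n c\<close> be the indicator function of a clopen set of
  points \<open>t\<close> that contain \<open>n\<close> and whose part up to \<open>n\<close> lies inside a member of
  \<open>\<S>\<^sub>k\<close>; in addition each \<open>q \<in> t\<close> prescribes a palette, and \<open>c\<close> must give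
  different colours from the palette of \<open>q\<close> to those first few elements of \<open>t\<close> after \<open>q\<close> that
  lie below \<open>n\<close>. The set \<open>K\<close> consists of all these functions.

  The averages \<open>y\<^sub>n\<close> of \<open>basic k n c\<close> over all \<open>c\<close> are large: the palette of \<open>q\<close> is so big
  that a random colouring satisfies all separation conditions with probability at least one
  half (\<open>half_of_colourings_separate\<close>). So on a member \<open>t\<close> of \<open>\<S>\<^sub>k\<close> all \<open>y\<^sub>n\<close> with \<open>n \<in> t\<close> are
  at least one half, and every subsequence of \<open>(y\<^sub>n)\<close> is an \<open>\<ell>\<^sub>1\<^sup>k\<close>-spreading model
  (\<open>averages_spreading_model\<close>).

  A sequence of individual functions \<open>basic k (n i) (c i)\<close> with increasing \<open>n i\<close> behaves
  differently. By Ramsey's theorem it has a subsequence in which every colouring gives a single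
  colour from the palette of \<open>q\<close> to all earlier indices past the first one that is at least \<open>q\<close>
  (\<open>coherent_subsequence\<close>). This contradicts separation as soon as four of the functions are nonzero at \<open>t\<close> with indices among the first \<open>q\<close> elements
  of \<open>t\<close> from some \<open>q\<close> on. The indices of the functions that are nonzero at a
  common point therefore form a set that is one Schreier level simpler
  (\<open>locally_sparse_imp_thin\<close>), and there are convex combinations supported on members of
  \<open>\<S>\<^sub>k\<close> that give arbitrarily small mass to all such sets (\<open>thin_invisible_average\<close>). Such
  combinations have small norm, even after changing signs, so the subsequence is weakly
  null and none of its subsequences is a spreading model. Thus \<open>K\<close> is \<open>k\<close>-weakly compact, while
  the averages in its convex hull have no \<open>k\<close>-weakly convergent subsequence.

  Local convexity fails for the same reason. The set of all \<open>y\<^sub>n\<close>, \<open>n \<ge> 1\<close>, is \<open>k\<close>-closed and omits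
  \<open>0\<close>, but a \<open>k\<close>-open set around \<open>0\<close> contains, for some \<open>n\<close>, all \<open>basic k n c\<close>, so that every
  convex set above it contains their average \<open>y\<^sub>n\<close>.
\<close>

section \<open>Schreier families\<close>

declare schreier.simps(2) [simp del]

lemma singleton_schreier:
  assumes "n \<ge> 1"
  shows "{n} \<in> schreier k"
proof (induction k)
  case (Suc k)
  have "{n} = (\<Union>i\<in>{1..1::nat}. (\<lambda>_. {n}) i)" by simp
  moreover have "\<forall>i\<in>{1..1::nat}. {n} \<noteq> {} \<and> {n} \<in> schreier k" using Suc by simp
  ultimately show ?case using assms
    unfolding schreier.simps by (intro UnI2 CollectI exI[of _ 1] exI[of _ "\<lambda>_. {n}"]) auto
qed (use assms in simp)

lemma schreier_SucE:
  assumes "G \<in> schreier (Suc k)" "G \<noteq> {}"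
  obtains m and E :: "nat \<Rightarrow> nat set" where "G = (\<Union>i\<in>{1..m}. E i)" "m \<ge> 1"
    "\<And>i. i \<in> {1..m} \<Longrightarrow> E i \<noteq> {} \<and> finite (E i) \<and> E i \<in> schreier k"
    "\<And>i j x y. \<lbrakk>i \<in> {1..m}; j \<in> {1..m}; i < j; x \<in> E i; y \<in> E j\<rbrakk> \<Longrightarrow> x < y"
    "\<And>x. x \<in> G \<Longrightarrow> m \<le> x"
proof -
  obtain m and E :: "nat \<Rightarrow> nat set" where G: "G = (\<Union>i\<in>{1..m}. E i)" and m: "m \<ge> 1"
    and E: "\<forall>i\<in>{1..m}. E i \<noteq> {} \<and> E i \<in> schreier k"
    and lt: "\<forall>i\<in>{1..m}. \<forall>j\<in>{1..m}. i < j \<longrightarrow> Max (E i) < Min (E j)"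
    and min: "m \<le> Min (E 1)"
    using assms unfolding schreier.simps by auto
  have fin: "finite (E i)" if "i \<in> {1..m}" for i
    using E that schreier_finite_pos by blast
  have ord: "x < y" if "i \<in> {1..m}" "j \<in> {1..m}" "i < j" "x \<in> E i" "y \<in> E j" for i j x y
  proof -
    have "x \<le> Max (E i)" "Min (E j) \<le> y" using fin that by simp_all
    then show ?thesis using lt that by (meson le_less_trans less_le_trans)
  qed
  have low: "m \<le> x" if x: "x \<in> G" for x
  proof -
    obtain i where i: "i \<in> {1..m}" "x \<in> E i" using x G by blast
    have 1: "Min (E 1) \<in> E 1" using fin[of 1] E m by (intro Min_in) auto
    show ?thesis
    proof (cases "i = 1")
      case True
      then show ?thesis using min i fin by (meson Min_le le_trans)
    next
      case False
      then show ?thesis using ord[of 1 i "Min (E 1)" x] i m 1 min by simp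
    qed
  qed
  show ?thesis
    by (rule that[OF G m]) (use E fin ord low in blast)+
qed

lemma schreier_SucI:
  assumes "m \<ge> 1" "\<And>i. i \<in> {1..m} \<Longrightarrow> E i \<noteq> {} \<and> E i \<in> schreier k"
    and "\<And>i j x y. \<lbrakk>i \<in> {1..m}; j \<in> {1..m}; i < j; x \<in> E i; y \<in> E j\<rbrakk> \<Longrightarrow> x < y"
    and "\<And>x. x \<in> E 1 \<Longrightarrow> m \<le> x"
  shows "(\<Union>i\<in>{1..m}. E i) \<in> schreier (Suc k)"
proof -
  have fin: "finite (E i)" if "i \<in> {1..m}" for i
    using assms(2) that schreier_finite_pos by blast
  have "Max (E i) < Min (E j)" if "i \<in> {1..m}" "j \<in> {1..m}" "i < j" for i j
    using assms(3)[OF that, of "Max (E i)" "Min (E j)"] assms(2) fin that by simp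
  moreover have "m \<le> Min (E 1)"
    using assms(1,2,4) fin[of 1] by simp
  ultimately show ?thesis
    using assms(1,2) unfolding schreier.simps by blast
qed

lemma schreier_spreading:
  assumes r: "strict_mono (r :: nat \<Rightarrow> nat)" and "E \<in> schreier k"
  shows "r ` E \<in> schreier k"
  using assms(2)
proof (induction k arbitrary: E)
  case 0
  have "r n \<ge> 1" if "n \<ge> 1" for n
    using strict_mono_imp_increasing[OF r, of n] that by linarith
  moreover have "E = {} \<or> (\<exists>n\<ge>1. E = {n})" using 0 by auto
  ultimately show ?case unfolding schreier.simps(1) by (elim disjE exE conjE) simp_all
next
  case (Suc k)
  show ?case
  proof (cases "E = {}")
    case False
    obtain m D where D: "E = (\<Union>i\<in>{1..m}. D i)" "m \<ge> 1"
      "\<And>i. i \<in> {1..m} \<Longrightarrow> D i \<noteq> {} \<and> finite (D i) \<and> D i \<in> schreier k"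
      "\<And>i j x y. \<lbrakk>i \<in> {1..m}; j \<in> {1..m}; i < j; x \<in> D i; y \<in> D j\<rbrakk> \<Longrightarrow> x < y"
      "\<And>x. x \<in> E \<Longrightarrow> m \<le> x"
      by (rule schreier_SucE[OF Suc.prems False]) blast
    have "(\<Union>i\<in>{1..m}. r ` D i) \<in> schreier (Suc k)"
    proof (rule schreier_SucI)
      show "x < y" if ij: "i \<in> {1..m}" "j \<in> {1..m}" "i < j" and xy: "x \<in> r ` D i" "y \<in> r ` D j"
        for i j x y
      proof -
        obtain x' y' where "x = r x'" "y = r y'" "x' \<in> D i" "y' \<in> D j" using xy by blast
        then show ?thesis using D(4)[OF ij] r by (simp add: strict_mono_less)
      qed
      show "m \<le> x" if x: "x \<in> r ` D 1" for x
      proof -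
        obtain y where "y \<in> D 1" "x = r y" using x by blast
        then have "m \<le> y" using D(1,2) by (intro D(5)) auto
        then show ?thesis using strict_mono_imp_increasing[OF r, of y] \<open>x = r y\<close> by simp
      qed
    qed (use D(2,3) Suc.IH in auto)
    then show ?thesis using D(1) by (simp add: image_UN)
  qed (simp add: schreier.simps(2))
qed

section \<open>Thin sets and averages that do not see them\<close>

text \<open>
  The Schreier construction started from the sets with at most three elements instead of the
  singletons. The estimates only compare the number of pieces with the minimum, so the pieces may
  overlap.
\<close>

primrec thin :: "nat \<Rightarrow> nat set set" where
  "thin 0 = {B. finite B \<and> card B \<le> 3}"
| "thin (Suc j) = {B. \<exists>(m::nat) (D :: nat \<Rightarrow> nat set). B = (\<Union>i\<in>{1..m}. D i) \<and>
     (\<forall>i\<in>{1..m}. D i \<in> thin j) \<and> (\<forall>b\<in>B. m \<le> b)}"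

declare thin.simps(2) [simp del]

text \<open>
  The condition \<open>card (F \<inter> {q..b}) \<le> q\<close> says that \<open>b\<close> is among the first \<open>q\<close> elements of \<open>F\<close> from
  \<open>q\<close> on, the longest stretch of \<open>F\<close> starting at \<open>q\<close> that belongs to \<open>\<S>\<^sub>1\<close>. Phrasing sparsity
  by all such stretches avoids choosing a decomposition of \<open>F\<close> into members of \<open>\<S>\<^sub>1\<close>.
\<close>

definition locally_sparse :: "nat set \<Rightarrow> nat set \<Rightarrow> bool" where
  "locally_sparse F B \<longleftrightarrow> (\<forall>q\<in>F. card {b\<in>B. q \<le> b \<and> card (F \<inter> {q..b}) \<le> q} \<le> 3)"

text \<open>
  A member of \<open>\<S>\<^sub>k\<^sub>+\<^sub>1\<close> is built from members of \<open>\<S>\<^sub>1\<close> in \<open>k\<close> further steps. A set meeting each of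
  these innermost pieces in at most three points inherits the outer \<open>k\<close> steps. Sparsity passes
  to the pieces of a decomposition because they are intervals of \<open>F\<close>, so that counting
  inside a piece agrees with counting inside \<open>F\<close>.
\<close>

lemma locally_sparse_imp_thin:
  assumes "G \<in> schreier (Suc k)" "F \<subseteq> G" "B \<subseteq> F" "locally_sparse F B"
  shows "B \<in> thin k"
  using assms
proof (induction k arbitrary: G F B)
  case 0
  show ?case
  proof (cases "F = {}")
    case False
    then have "G \<noteq> {}" using 0 by blast
    then obtain m E where E: "G = (\<Union>i\<in>{1..m}. E i)" "m \<ge> 1"
      "\<And>i. i \<in> {1..m} \<Longrightarrow> E i \<noteq> {} \<and> finite (E i) \<and> E i \<in> schreier 0"
      "\<And>x. x \<in> G \<Longrightarrow> m \<le> x"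
      by (rule schreier_SucE[OF "0.prems"(1)]) blast
    have finG: "finite G" using E(1,3) by simp
    have "card G \<le> (\<Sum>i\<in>{1..m}. card (E i))" unfolding E(1) by (rule card_UN_le) simp
    also have "\<dots> \<le> (\<Sum>i\<in>{1..m}. 1)"
      using E(3) by (intro sum_mono) force
    finally have cG: "card G \<le> m" by simp
    have finF: "finite F" using finite_subset[OF "0.prems"(2) finG] .
    define q where "q = Min F"
    have q: "q \<in> F" unfolding q_def using finF False by simp
    have "card (F \<inter> {q..b}) \<le> q" for b
    proof -
      have "card (F \<inter> {q..b}) \<le> card G" using finG "0.prems"(2) by (intro card_mono) auto
      also have "\<dots> \<le> q" using cG E(4)[of q] q "0.prems"(2) by fastforce
      finally show ?thesis .
    qed
    moreover have "q \<le> b" if "b \<in> B" for b using that "0.prems"(3) finF q_def by auto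
    ultimately have "{b\<in>B. q \<le> b \<and> card (F \<inter> {q..b}) \<le> q} = B" by blast
    then have "card B \<le> 3" using "0.prems"(4) q unfolding locally_sparse_def by fastforce
    then show ?thesis using finite_subset[OF "0.prems"(3) finF] by simp
  qed (use 0 in simp)
next
  case (Suc k)
  show ?case
  proof (cases "G = {}")
    case True
    then have "B = {}" using Suc.prems by simp
    moreover have "{} = (\<Union>i\<in>{1..0::nat}. (\<lambda>_. {} :: nat set) i)" by simp
    ultimately show ?thesis unfolding thin.simps by fastforce
  next
    case False
    obtain m E where E: "G = (\<Union>i\<in>{1..m}. E i)" "m \<ge> 1"
      "\<And>i. i \<in> {1..m} \<Longrightarrow> E i \<noteq> {} \<and> finite (E i) \<and> E i \<in> schreier (Suc k)"
      "\<And>i j x y. \<lbrakk>i \<in> {1..m}; j \<in> {1..m}; i < j; x \<in> E i; y \<in> E j\<rbrakk> \<Longrightarrow> x < y"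
      "\<And>x. x \<in> G \<Longrightarrow> m \<le> x"
      by (rule schreier_SucE[OF Suc.prems(1) False]) blast
    have "B \<inter> E i \<in> thin k" if i: "i \<in> {1..m}" for i
    proof (rule Suc.IH)
      show "E i \<in> schreier (Suc k)" using E(3) i by blast
      show "F \<inter> E i \<subseteq> E i" "B \<inter> E i \<subseteq> F \<inter> E i" using Suc.prems by auto
      have "card {b \<in> B \<inter> E i. q \<le> b \<and> card (F \<inter> E i \<inter> {q..b}) \<le> q} \<le> 3"
        if q: "q \<in> F \<inter> E i" for q
      proof -
        have "F \<inter> E i \<inter> {q..b} = F \<inter> {q..b}" if b: "b \<in> E i" for b
        proof -
          have "x \<in> E i" if x: "x \<in> F" "q \<le> x" "x \<le> b" for x
          proof -
            obtain j where j: "j \<in> {1..m}" "x \<in> E j" using x(1) Suc.prems(2) E(1) by blast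
            have "\<not> i < j" using E(4)[OF i j(1) _ b j(2)] x(3) by fastforce
            moreover have "\<not> j < i" using E(4)[OF j(1) i _ j(2), of q] x(2) q by fastforce
            ultimately show ?thesis using j(2) by (metis linorder_neqE_nat)
          qed
          then show ?thesis by auto
        qed
        then have "{b \<in> B \<inter> E i. q \<le> b \<and> card (F \<inter> E i \<inter> {q..b}) \<le> q}
            \<subseteq> {b \<in> B. q \<le> b \<and> card (F \<inter> {q..b}) \<le> q}" by auto
        moreover have "finite B"
          using Suc.prems(1-3) schreier_finite_pos finite_subset by metis
        ultimately have "card {b \<in> B \<inter> E i. q \<le> b \<and> card (F \<inter> E i \<inter> {q..b}) \<le> q}
            \<le> card {b \<in> B. q \<le> b \<and> card (F \<inter> {q..b}) \<le> q}"
          by (intro card_mono) auto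
        then show ?thesis using Suc.prems(4) q unfolding locally_sparse_def by fastforce
      qed
      then show "locally_sparse (F \<inter> E i) (B \<inter> E i)" unfolding locally_sparse_def by blast
    qed
    moreover have "B = (\<Union>i\<in>{1..m}. B \<inter> E i)" using Suc.prems E(1) by blast
    moreover have "\<forall>b\<in>B. m \<le> b" using Suc.prems E(5) by blast
    ultimately show ?thesis
      unfolding thin.simps by (intro CollectI exI[of _ m] exI[of _ "\<lambda>i. B \<inter> E i"]) blast
  qed
qed

lemma sum_UN_le:
  fixes f :: "'a \<Rightarrow> real"
  assumes "finite I" "\<And>i. i \<in> I \<Longrightarrow> finite (A i)" "\<And>i x. \<lbrakk>i \<in> I; x \<in> A i\<rbrakk> \<Longrightarrow> f x \<ge> 0"
  shows "sum f (\<Union>i\<in>I. A i) \<le> (\<Sum>i\<in>I. sum f (A i))"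
  using assms
proof (induction I rule: finite_induct)
  case (insert i I)
  have "sum f (A i \<inter> (\<Union>i\<in>I. A i)) \<ge> 0" using insert.prems by (intro sum_nonneg) auto
  moreover have "sum f (A i \<union> (\<Union>i\<in>I. A i)) + sum f (A i \<inter> (\<Union>i\<in>I. A i))
      = sum f (A i) + sum f (\<Union>i\<in>I. A i)"
    using insert by (intro sum.union_inter) auto
  moreover have "sum f (\<Union>i\<in>I. A i) \<le> (\<Sum>i\<in>I. sum f (A i))"
    by (rule insert.IH) (use insert.prems in auto)
  ultimately show ?case using insert.hyps by simp
qed simp

text \<open>
  These are the repeated averages of Schreier theory. One step averages \<open>L\<close> consecutive blocks, each
  carrying an average from the previous level whose tolerance is chosen after the preceding
  block. If \<open>B\<close> meets a block, then the number of pieces of \<open>B\<close> is bounded by a number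
  that was known before the later blocks were chosen, so \<open>B\<close> has small mass in all
  of those. Only the first block that \<open>B\<close> meets can contribute substantially, and
  it counts \<open>1 / L\<close>. The map \<open>n\<close> is there because membership in \<open>\<S>\<close> refers to positions in a
  subsequence, but thinness to the original indices.
\<close>

lemma thin_invisible_average:
  fixes n :: "nat \<Rightarrow> nat"
  assumes n: "strict_mono n" and "\<epsilon> > 0"
  shows "\<exists>E (a :: nat \<Rightarrow> real). E \<in> schreier (Suc j) \<and> E \<noteq> {} \<and> E \<subseteq> {M..} \<and> (\<forall>i\<in>E. a i \<ge> 0) \<and>
    (\<Sum>i\<in>E. a i) = 1 \<and> (\<forall>B\<in>thin j. (\<Sum>i | i \<in> E \<and> n i \<in> B. a i) \<le> \<epsilon>)"
  using assms(2)
proof (induction j arbitrary: \<epsilon> M)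
  case 0
  obtain L :: nat where L: "L \<ge> max 1 M" "3 / \<epsilon> \<le> real L"
    using real_arch_simple[of "max (real (max 1 M)) (3 / \<epsilon>)"] by auto
  define E where "E = {L..<2*L}"
  have "(\<Union>i\<in>{1..L}. {L + i - 1}) \<in> schreier (Suc 0)"
    by (rule schreier_SucI) (use L in auto)
  moreover have "(\<Union>i\<in>{1..L}. {L + i - 1}) = E"
  proof -
    have "x \<in> (\<Union>i\<in>{1..L}. {L + i - 1})" if "x \<in> E" for x
      using that unfolding E_def by (intro UN_I[of "x + 1 - L"]) auto
    then show ?thesis unfolding E_def by auto
  qed
  ultimately have "E \<in> schreier (Suc 0)" by simp
  moreover have "E \<noteq> {}" "E \<subseteq> {M..}" unfolding E_def using L by auto
  moreover have "(\<Sum>i\<in>E. 1 / real L) = 1" using L by (simp add: E_def)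
  moreover have "(\<Sum>i | i \<in> E \<and> n i \<in> B. 1 / real L) \<le> \<epsilon>" if B: "B \<in> thin 0" for B
  proof -
    have "card {i. i \<in> E \<and> n i \<in> B} \<le> card B"
      using n B by (intro card_inj_on_le[of n]) (auto simp: strict_mono_eq inj_on_def)
    also have "\<dots> \<le> 3" using B by simp
    finally have "real (card {i. i \<in> E \<and> n i \<in> B}) / real L \<le> 3 / real L"
      by (intro divide_right_mono) auto
    also have "\<dots> \<le> \<epsilon>" using L 0 by (simp add: field_simps)
    finally show ?thesis by simp
  qed
  ultimately show ?case by (intro exI[of _ E] exI[of _ "\<lambda>_. 1 / real L"]) auto
next
  case (Suc j)
  \<comment> \<open>A set of the next level that contains \<open>n x\<close> for some \<open>x < s\<close> has at most \<open>n s\<close> pieces.\<close>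
  define \<delta> where "\<delta> s = \<epsilon> / 2 / (real (n s) + 1)" for s
  have \<delta>: "\<delta> s > 0" for s using Suc.prems by (simp add: \<delta>_def)
  define Q where "Q s E a \<longleftrightarrow> E \<in> schreier (Suc j) \<and> E \<noteq> {} \<and> E \<subseteq> {s..} \<and>
     (\<forall>i\<in>E. a i \<ge> 0) \<and> (\<Sum>i\<in>E. a i) = 1 \<and>
     (\<forall>B\<in>thin j. (\<Sum>i | i \<in> E \<and> n i \<in> B. a i) \<le> \<delta> s)"
    for s E and a :: "nat \<Rightarrow> real"
  have "\<exists>E a. Q s E a" for s
    unfolding Q_def by (rule Suc.IH[OF \<delta>])
  then obtain E' a' where EA: "\<And>s. Q s (E' s) (a' s)" by metis
  obtain L :: nat where L: "L \<ge> max 1 M" "2 / \<epsilon> \<le> real L"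
    using real_arch_simple[of "max (real (max 1 M)) (2 / \<epsilon>)"] by auto
  define s where "s = rec_nat L (\<lambda>_ s. Suc (Max (E' s)))"
  have s_simps: "s 0 = L" "s (Suc i) = Suc (Max (E' (s i)))" for i by (simp_all add: s_def)
  define E a where "E i = E' (s i)" and "a i = a' (s i)" for i
  have fin: "finite (E i)" for i unfolding E_def using EA[of "s i"] schreier_finite_pos unfolding Q_def by blast
  have ne: "E i \<noteq> {}" and Ein: "E i \<in> schreier (Suc j)" and low: "\<And>x. x \<in> E i \<Longrightarrow> s i \<le> x"
    and a0: "\<And>x. x \<in> E i \<Longrightarrow> a i x \<ge> 0" and a1: "(\<Sum>x\<in>E i. a i x) = 1"
    and aB: "\<And>B. B \<in> thin j \<Longrightarrow> (\<Sum>x | x \<in> E i \<and> n x \<in> B. a i x) \<le> \<delta> (s i)" for i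
    using EA[of "s i"] unfolding E_def a_def Q_def by auto
  have up: "x < s (Suc i)" if "x \<in> E i" for x i
    using fin[of i] that unfolding s_simps E_def by (simp add: less_Suc_eq_le)
  have "s i < s (Suc i)" for i using up low ne by (meson all_not_in_conv le_less_trans)
  then have smono: "strict_mono s" by (rule strict_mono_Suc_iff[THEN iffD2, rule_format])
  have ord: "x < s i'" if "i < i'" "x \<in> E i" for i i' x
    using up[OF that(2)] that(1) smono by (meson Suc_leI less_le_trans strict_mono_less_eq)
  have disj: "E i \<inter> E i' = {}" if "i \<noteq> i'" for i i'
  proof -
    have "E i \<inter> E i' = {}" if "i < i'" for i i'
      using ord[OF that] low[of _ i'] by fastforce
    then show ?thesis using that by (metis Int_commute linorder_neqE_nat)
  qed
  define A where "A x = (\<Sum>i\<in>{1..L}. if x \<in> E i then a i x else 0) / real L" for x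
  have A: "A x = a i x / real L" if "i \<in> {1..L}" "x \<in> E i" for x i
  proof -
    have "(\<Sum>i'\<in>{1..L}. if x \<in> E i' then a i' x else 0) = (\<Sum>i'\<in>{1..L}. if i' = i then a i x else 0)"
      using disj that by (intro sum.cong) auto
    also have "\<dots> = a i x" using that by simp
    finally show ?thesis by (simp add: A_def)
  qed
  have sumA: "(\<Sum>x | x \<in> (\<Union>i\<in>{1..L}. E i) \<and> n x \<in> B. A x)
      = (\<Sum>i\<in>{1..L}. \<Sum>x | x \<in> E i \<and> n x \<in> B. a i x) / real L" for B
  proof -
    have "{x. x \<in> (\<Union>i\<in>{1..L}. E i) \<and> n x \<in> B} = (\<Union>i\<in>{1..L}. {x. x \<in> E i \<and> n x \<in> B})" by auto
    then have "(\<Sum>x | x \<in> (\<Union>i\<in>{1..L}. E i) \<and> n x \<in> B. A x)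
        = (\<Sum>i\<in>{1..L}. \<Sum>x | x \<in> E i \<and> n x \<in> B. A x)"
      using fin disj by (simp add: sum.UNION_disjoint disjoint_iff)
    also have "\<dots> = (\<Sum>i\<in>{1..L}. \<Sum>x | x \<in> E i \<and> n x \<in> B. a i x / real L)"
      using A by (intro sum.cong) auto
    finally show ?thesis by (simp add: sum_divide_distrib)
  qed
  show ?case
  proof (intro exI[of _ "\<Union>i\<in>{1..L}. E i"] exI[of _ A] conjI ballI)
    show "(\<Union>i\<in>{1..L}. E i) \<in> schreier (Suc (Suc j))"
    proof (rule schreier_SucI)
      show "x < y" if "i < i'" "x \<in> E i" "y \<in> E i'" for i i' x y
        using ord[OF that(1,2)] low[OF that(3)] by simp
      show "L \<le> x" if "x \<in> E 1" for x
        using ord[of 0 1] low[OF that] strict_mono_less_eq[OF smono, of 0 1] s_simps(1) by simp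
    qed (use L ne Ein in auto)
    show "(\<Union>i\<in>{1..L}. E i) \<noteq> {}" using ne L by auto
    have "M \<le> x" if "x \<in> E i" for x i
      using low[OF that] strict_mono_less_eq[OF smono, of 0 i] s_simps(1) L by simp
    then show "(\<Union>i\<in>{1..L}. E i) \<subseteq> {M..}" by auto
    show "A x \<ge> 0" if "x \<in> (\<Union>i\<in>{1..L}. E i)" for x
      using that A a0 by auto
    show "(\<Sum>x\<in>(\<Union>i\<in>{1..L}. E i). A x) = 1"
    proof -
      have "{x. x \<in> (\<Union>i\<in>{1..L}. E i) \<and> n x \<in> UNIV} = (\<Union>i\<in>{1..L}. E i)" by blast
      then show ?thesis using sumA[of UNIV] a1 L by simp
    qed
  next
    fix B assume "B \<in> thin (Suc j)"
    then obtain m D where D: "B = (\<Union>i\<in>{1..m}. D i)" "\<And>i. i \<in> {1..m} \<Longrightarrow> D i \<in> thin j"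
      "\<And>b. b \<in> B \<Longrightarrow> m \<le> b" unfolding thin.simps mem_Collect_eq by blast
    define v where "v i = (\<Sum>x | x \<in> E i \<and> n x \<in> B. a i x)" for i
    have v1: "v i \<le> 1" for i
      unfolding v_def a1[of i, symmetric] using fin a0 by (intro sum_mono2) auto
    have v_small: "v i \<le> \<epsilon> / 2" if hit: "i0 < i" "x0 \<in> E i0" "n x0 \<in> B" for i i0 x0
    proof -
      have "v i \<le> (\<Sum>l\<in>{1..m}. \<Sum>x | x \<in> E i \<and> n x \<in> D l. a i x)"
      proof -
        have "{x. x \<in> E i \<and> n x \<in> B} = (\<Union>l\<in>{1..m}. {x. x \<in> E i \<and> n x \<in> D l})"
          using D(1) by auto
        then show ?thesis unfolding v_def
          using fin a0 by (auto intro!: sum_UN_le)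
      qed
      also have "\<dots> \<le> (\<Sum>l\<in>{1..m}. \<delta> (s i))" using aB D(2) by (intro sum_mono) auto
      also have "\<dots> = real m * \<delta> (s i)" by simp
      also have "\<dots> \<le> (real (n (s i)) + 1) * \<delta> (s i)"
      proof (rule mult_right_mono)
        have "m \<le> n x0" using D(3) hit by blast
        also have "\<dots> \<le> n (s i)"
          using ord[OF hit(1,2)] n by (simp add: strict_mono_less_eq)
        finally show "real m \<le> real (n (s i)) + 1" by simp
        show "\<delta> (s i) \<ge> 0" using Suc.prems by (simp add: \<delta>_def)
      qed
      also have "\<dots> = \<epsilon> / 2" by (simp add: \<delta>_def field_simps)
      finally show ?thesis .
    qed
    have "(\<Sum>i\<in>{1..L}. v i) \<le> 1 + real L * (\<epsilon> / 2)"
    proof (cases "\<exists>i x. x \<in> E i \<and> n x \<in> B")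
      case False
      then have "v i = 0" for i unfolding v_def by (metis (mono_tags, lifting) empty_Collect_eq sum.empty)
      then show ?thesis using Suc.prems by simp
    next
      case True
      define i0 where "i0 = (LEAST i. \<exists>x. x \<in> E i \<and> n x \<in> B)"
      obtain x0 where x0: "x0 \<in> E i0" "n x0 \<in> B"
        using LeastI_ex[OF True] unfolding i0_def by blast
      have "v i \<le> \<epsilon> / 2" if "i \<noteq> i0" for i
      proof (cases "i0 < i")
        case True
        then show ?thesis using v_small x0 by blast
      next
        case False
        then have "\<not> (\<exists>x. x \<in> E i \<and> n x \<in> B)"
          using that not_less_Least unfolding i0_def by (metis (lifting) linorder_neqE_nat)
        then have "v i = 0" unfolding v_def by (metis (mono_tags, lifting) empty_Collect_eq sum.empty)
        then show ?thesis using Suc.prems by simp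
      qed
      then have "v i \<le> \<epsilon> / 2 + (if i = i0 then 1 else 0)" for i
        using v1[of i] Suc.prems by (cases "i = i0") (auto intro: add_increasing)
      then have "(\<Sum>i\<in>{1..L}. v i) \<le> (\<Sum>i\<in>{1..L}. \<epsilon> / 2 + (if i = i0 then 1 else 0))"
        by (intro sum_mono)
      also have "\<dots> \<le> 1 + real L * (\<epsilon> / 2)" by (simp add: sum.distrib)
      finally show ?thesis .
    qed
    then have "(\<Sum>i\<in>{1..L}. v i) / real L \<le> (1 + real L * (\<epsilon> / 2)) / real L"
      by (intro divide_right_mono) auto
    also have "\<dots> \<le> \<epsilon>" using L Suc.prems by (simp add: field_simps)
    finally show "(\<Sum>x | x \<in> (\<Union>i\<in>{1..L}. E i) \<and> n x \<in> B. A x) \<le> \<epsilon>"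
      unfolding sumA v_def .
  qed
qed

section \<open>Random colourings\<close>

text \<open>
  There are at most \<open>q\<^sup>2\<close> pairs that the palette of \<open>q\<close> has to separate, so the probabilities of a
  collision add up to at most the sum of \<open>1 / 2 ^ (q + 2)\<close> over all \<open>q\<close>, which is one half.
\<close>

definition colours :: "nat \<Rightarrow> nat" where
  "colours q = (q\<^sup>2 + 1) * 2 ^ (q + 2)"

definition colourings :: "nat \<Rightarrow> (nat \<times> nat \<Rightarrow> nat) set" where
  "colourings n = PiE ({..n} \<times> {..n}) (\<lambda>(q, i). {..<colours q})"

text \<open>
  In \<open>c (q, i)\<close> the first argument names the palette and the second the coloured number. The
  restriction \<open>j < n\<close> leaves \<open>n\<close> itself out: only earlier elements are compared, and their
  colours are the ones that can be stabilised along a subsequence.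
\<close>

definition separates :: "nat set \<Rightarrow> nat \<Rightarrow> (nat \<times> nat \<Rightarrow> nat) \<Rightarrow> bool" where
  "separates F n c \<longleftrightarrow> (\<forall>q\<in>F. \<forall>i\<in>F. \<forall>j\<in>F. q < i \<and> i < j \<and> j < n \<and> card (F \<inter> {q..j}) \<le> q \<longrightarrow>
     c (q, i) \<noteq> c (q, j))"

lemma colours_pos: "colours q > 0"
  by (simp add: colours_def)

lemma finite_colourings: "finite (colourings n)"
  unfolding colourings_def by (intro finite_PiE) auto

lemma card_colourings_pos: "card (colourings n) > 0"
proof -
  have "colourings n \<noteq> {}"
    unfolding colourings_def using colours_pos by (auto simp: PiE_eq_empty_iff)
  then show ?thesis using finite_colourings by (simp add: card_gt_0_iff)
qed

text \<open>
  The values at two different places agree with probability at most one over the number of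
  values: overwriting the value at \<open>p\<close> arbitrarily is injective on functions with \<open>g p = g p'\<close>,
  since the old value survives at \<open>p'\<close>.
\<close>

lemma card_PiE_collision:
  assumes "finite S" "\<And>x. x \<in> S \<Longrightarrow> finite (T x)" "p \<in> S" "p' \<in> S" "p \<noteq> p'"
  shows "card {g \<in> PiE S T. g p = g p'} * card (T p) \<le> card (PiE S T)"
proof -
  have "card ({g \<in> PiE S T. g p = g p'} \<times> T p) \<le> card (PiE S T)"
  proof (rule card_inj_on_le)
    show "inj_on (\<lambda>(g, v). g(p := v)) ({g \<in> PiE S T. g p = g p'} \<times> T p)"
    proof (rule inj_onI, clarsimp)
      fix g h v w assume g: "g p = g p'" and h: "h p = h p'" and eq: "g(p := v) = h(p := w)"
      have "g x = h x" for x
        using fun_cong[OF eq, of x] fun_cong[OF eq, of p'] g h assms(5) by (cases "x = p") auto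
      moreover have "v = w" using fun_cong[OF eq, of p] by simp
      ultimately show "g = h \<and> v = w" by blast
    qed
    show "(\<lambda>(g, v). g(p := v)) ` ({g \<in> PiE S T. g p = g p'} \<times> T p) \<subseteq> PiE S T"
      using assms(3) by (auto simp: PiE_iff extensional_def)
    show "finite (PiE S T)" using assms by (intro finite_PiE) auto
  qed
  then show ?thesis by (simp add: card_cartesian_product)
qed

lemma card_first_elements:
  fixes F :: "nat set"
  shows "card {i\<in>F. q < i \<and> i < n \<and> card (F \<inter> {q..i}) \<le> q} \<le> q" (is "card ?X \<le> q")
proof -
  have less: "card (F \<inter> {q..i}) < card (F \<inter> {q..j})" if "i < j" "j \<in> ?X" for i j
  proof (rule psubset_card_mono)
    have "j \<in> F \<inter> {q..j} - F \<inter> {q..i}" using that by auto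
    moreover have "F \<inter> {q..i} \<subseteq> F \<inter> {q..j}" using that by auto
    ultimately show "F \<inter> {q..i} \<subset> F \<inter> {q..j}" by blast
  qed simp
  have "card ?X \<le> card {1..q}"
  proof (rule card_inj_on_le)
    show "inj_on (\<lambda>i. card (F \<inter> {q..i})) ?X"
    proof (rule inj_onI)
      fix i j assume "i \<in> ?X" "j \<in> ?X" "card (F \<inter> {q..i}) = card (F \<inter> {q..j})"
      then show "i = j" using less[of i j] less[of j i] by (cases i j rule: linorder_cases) auto
    qed
    have "card (F \<inter> {q..i}) \<ge> 1" if "i \<in> ?X" for i
      using that by (simp add: Suc_le_eq card_gt_0_iff) force
    then show "(\<lambda>i. card (F \<inter> {q..i})) ` ?X \<subseteq> {1..q}" by auto
  qed simp
  then show ?thesis by simp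
qed

text \<open>
  A union bound over all palettes \<open>q < n\<close> and all pairs among the first \<open>q\<close> elements of \<open>F\<close>
  from \<open>q\<close> on.
\<close>

lemma half_of_colourings_separate:
  "card (colourings n) / 2 \<le> real (card {c \<in> colourings n. separates F n c})"
proof -
  let ?N = "real (card (colourings n))"
  define X where "X q = {i\<in>F. q < i \<and> i < n \<and> card (F \<inter> {q..i}) \<le> q}" for q
  define P where "P q = {(i, j). i \<in> X q \<and> j \<in> X q \<and> i < j}" for q
  define bad where "bad q p = {c \<in> colourings n. c (q, fst p) = c (q, snd p)}" for q p
  have finX: "finite (X q)" for q
    by (rule finite_subset[of _ "{..<n}"]) (auto simp: X_def)
  have P_sub: "P q \<subseteq> X q \<times> X q" for q by (auto simp: P_def)
  have finP: "finite (P q)" for q using finX finite_subset[OF P_sub] by blast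
  have cardP: "real (card (P q)) \<le> real (q\<^sup>2)" for q
  proof -
    have "card (P q) \<le> card (X q \<times> X q)" using P_sub finX by (intro card_mono) auto
    also have "\<dots> \<le> q * q"
      unfolding card_cartesian_product X_def by (intro mult_mono card_first_elements) auto
    finally show ?thesis unfolding of_nat_le_iff power2_eq_square .
  qed
  have finbad: "finite (bad q p)" for q p
    using finite_colourings by (simp add: bad_def)
  have cardbad: "real (card (bad q p)) \<le> ?N / colours q" if "q < n" "p \<in> P q" for q p
  proof -
    have "card (bad q p) * colours q \<le> card (colourings n)"
      using card_PiE_collision[of "{..n} \<times> {..n}" "\<lambda>(q, i). {..<colours q}" "(q, fst p)" "(q, snd p)"]
        that unfolding bad_def colourings_def P_def X_def by auto
    then have "real (card (bad q p)) * real (colours q) \<le> ?N"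
      by (metis of_nat_le_iff of_nat_mult)
    then show ?thesis using colours_pos[of q] by (simp add: field_simps)
  qed
  have "colourings n - {c \<in> colourings n. separates F n c} \<subseteq> (\<Union>q\<in>{..<n}. \<Union>p\<in>P q. bad q p)"
  proof
    fix c assume "c \<in> colourings n - {c \<in> colourings n. separates F n c}"
    then obtain q i j where c: "c \<in> colourings n" and q: "q \<in> F" "i \<in> F" "j \<in> F" "q < i" "i < j" "j < n"
      "card (F \<inter> {q..j}) \<le> q" "c (q, i) = c (q, j)" unfolding separates_def by blast
    have "card (F \<inter> {q..i}) \<le> card (F \<inter> {q..j})" using q by (intro card_mono) auto
    then have "(i, j) \<in> P q" unfolding P_def X_def using q by auto
    moreover have "c \<in> bad q (i, j)" unfolding bad_def using c q by simp
    ultimately show "c \<in> (\<Union>q\<in>{..<n}. \<Union>p\<in>P q. bad q p)" using q by fastforce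
  qed
  then have "card (colourings n - {c \<in> colourings n. separates F n c})
      \<le> card (\<Union>q\<in>{..<n}. \<Union>p\<in>P q. bad q p)"
    using finP finbad by (intro card_mono) auto
  also have "\<dots> \<le> (\<Sum>q<n. card (\<Union>p\<in>P q. bad q p))" by (rule card_UN_le) simp
  also have "\<dots> \<le> (\<Sum>q<n. \<Sum>p\<in>P q. card (bad q p))"
    by (intro sum_mono card_UN_le finP)
  finally have "real (card (colourings n - {c \<in> colourings n. separates F n c}))
      \<le> (\<Sum>q<n. \<Sum>p\<in>P q. real (card (bad q p)))"
    unfolding of_nat_sum[symmetric] of_nat_le_iff .
  also have "\<dots> \<le> (\<Sum>q<n. ?N * (1 / 2 ^ (q + 2)))"
  proof (rule sum_mono)
    fix q assume q: "q \<in> {..<n}"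
    have "(\<Sum>p\<in>P q. real (card (bad q p))) \<le> (\<Sum>p\<in>P q. ?N / colours q)"
      using cardbad q by (intro sum_mono) auto
    also have "\<dots> = real (card (P q)) * (?N / colours q)" by simp
    also have "\<dots> \<le> (real (q\<^sup>2) + 1) * (?N / colours q)"
      by (intro mult_right_mono order_trans[OF cardP]) simp_all
    also have "\<dots> = ?N * (1 / 2 ^ (q + 2))"
    proof -
      have "real (colours q) = (real (q\<^sup>2) + 1) * 2 ^ (q + 2)" unfolding colours_def by (simp add: algebra_simps)
      moreover have "real (q\<^sup>2) + 1 \<noteq> 0" by (metis add_nonneg_eq_0_iff of_nat_0_le_iff zero_le_one zero_neq_one)
      ultimately show ?thesis by simp
    qed
    finally show "(\<Sum>p\<in>P q. real (card (bad q p))) \<le> ?N * (1 / 2 ^ (q + 2))" .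
  qed
  also have "\<dots> = ?N * (\<Sum>q<n. 1 / 2 ^ (q + 2))" by (simp add: sum_distrib_left)
  also have "\<dots> \<le> ?N * (1 / 2)"
  proof (rule mult_left_mono)
    have "(\<Sum>q<n. 1 / 2 ^ (q + 2)) = (1 / 2 - 1 / 2 ^ (n + 1) :: real)"
      by (induction n) (auto simp: field_simps)
    then show "(\<Sum>q<n. 1 / 2 ^ (q + 2)) \<le> (1 / 2 :: real)" by simp
  qed simp
  finally have "real (card (colourings n - {c \<in> colourings n. separates F n c})) \<le> ?N / 2" by simp
  moreover have "card (colourings n - {c \<in> colourings n. separates F n c})
      = card (colourings n) - card {c \<in> colourings n. separates F n c}"
    using finite_colourings by (intro card_Diff_subset) auto
  moreover have "card {c \<in> colourings n. separates F n c} \<le> card (colourings n)"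
    using finite_colourings by (intro card_mono) auto
  ultimately show ?thesis by (simp add: of_nat_diff)
qed

section \<open>Coherent sequences of colourings and their traces\<close>

text \<open>
  For each colouring of the sequence, the palettes up to an earlier index cannot tell apart the
  indices that lie strictly between the two.
\<close>

definition coherent :: "(nat \<Rightarrow> nat) \<Rightarrow> (nat \<Rightarrow> nat \<times> nat \<Rightarrow> nat) \<Rightarrow> bool" where
  "coherent n c \<longleftrightarrow> (\<forall>i j k l q. i < j \<and> j < k \<and> k < l \<and> q \<le> n i \<longrightarrow> c l (q, n j) = c l (q, n k))"

text \<open>
  Ramsey's theorem for four-element sets makes the defining condition of coherence hold always or
  never. It cannot fail always: the colours which a fixed late colouring assigns from the
  finitely many palettes up to the first index take boundedly many values, so among sufficiently many
  indices in between two receive the same ones.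
\<close>

lemma coherent_subsequence:
  assumes n: "strict_mono n" and c: "\<And>i. c i \<in> colourings (n i)"
  obtains r :: "nat \<Rightarrow> nat" where "strict_mono r" "coherent (n \<circ> r) (c \<circ> r)"
proof -
  define good where "good i j k l \<longleftrightarrow> (\<forall>q\<le>n i. c l (q, n j) = c l (q, n k))" for i j k l
  define f :: "nat set \<Rightarrow> nat" where "f X = (let L = sorted_list_of_set X in
    if good (L ! 0) (L ! 1) (L ! 2) (L ! 3) then 0 else 1)" for X
  have f: "f {i, j, k, l} = (if good i j k l then 0 else 1)" if "i < j" "j < k" "k < l" for i j k l
  proof -
    have "sorted_list_of_set (set [i, j, k, l]) = [i, j, k, l]"
      using that by (intro sorted_list_of_set.idem_if_sorted_distinct) auto
    then show ?thesis unfolding f_def by (simp add: numeral_2_eq_2 numeral_3_eq_3)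
  qed
  have "f X < 2" for X by (simp add: f_def Let_def)
  then obtain Y t where Y: "infinite Y" "\<forall>X. X \<subseteq> Y \<and> finite X \<and> card X = 4 \<longrightarrow> f X = t"
    using Ramsey[of "UNIV :: nat set" 4 f 2] by auto
  define r where "r = enumerate Y"
  have r: "strict_mono r" "\<And>i. r i \<in> Y"
    unfolding r_def using Y(1) by (simp_all add: strict_mono_def enumerate_mono enumerate_in_set)
  have ft: "f {r i, r j, r k, r l} = t" if "i < j" "j < k" "k < l" for i j k l
  proof -
    have "card {r i, r j, r k, r l} = 4"
      using that r(1) by (simp add: strict_mono_eq)
    then show ?thesis using Y(2) r(2) by simp
  qed
  have less: "r i < r j" if "i < j" for i j using r(1) that by (simp add: strict_mono_less)
  have t: "t = (if good (r i) (r j) (r k) (r l) then 0 else 1)" if "i < j" "j < k" "k < l" for i j k l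
    using ft[OF that] f less that by metis
  \<comment> \<open>A quadruple on which the condition holds: \<open>\<kappa> x\<close> is the vector of colours of the index \<open>x\<close>.\<close>
  define T where "T = PiE {..n (r 0)} (\<lambda>q. {..<colours q})"
  define l where "l = card T + 2"
  define \<kappa> where "\<kappa> x = restrict (\<lambda>q. c (r l) (q, n (r x))) {..n (r 0)}" for x
  have "finite T" unfolding T_def by (intro finite_PiE) auto
  have "\<kappa> ` {1..card T + 1} \<subseteq> T"
  proof
    fix y assume "y \<in> \<kappa> ` {1..card T + 1}"
    then obtain x where x: "x \<in> {1..card T + 1}" "y = \<kappa> x" by blast
    have "n (r 0) \<le> n (r l)" "n (r x) \<le> n (r l)"
      using x(1) n r(1) unfolding l_def by (simp_all add: strict_mono_less_eq)
    then have "c (r l) (q, n (r x)) < colours q" if "q \<le> n (r 0)" for q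
      using c[of "r l"] that unfolding colourings_def by (auto simp: PiE_iff)
    then show "y \<in> T" unfolding x(2) \<kappa>_def T_def by auto
  qed
  then have "card (\<kappa> ` {1..card T + 1}) \<le> card T" using \<open>finite T\<close> by (intro card_mono)
  then have "\<not> inj_on \<kappa> {1..card T + 1}"
    using card_image[of \<kappa> "{1..card T + 1}"] by auto
  then obtain x y where "x \<in> {1..card T + 1}" "y \<in> {1..card T + 1}" "x < y" "\<kappa> x = \<kappa> y"
    by (metis (no_types, lifting) inj_onI linorder_neqE_nat)
  then have xy: "0 < x" "x < y" "y < l" "\<kappa> x = \<kappa> y" unfolding l_def by auto
  have "good (r 0) (r x) (r y) (r l)" unfolding good_def
  proof (intro allI impI)
    fix q assume "q \<le> n (r 0)"
    then show "c (r l) (q, n (r x)) = c (r l) (q, n (r y))"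
      using fun_cong[OF xy(4), of q] unfolding \<kappa>_def by simp
  qed
  then have "t = 0" using t[OF xy(1-3)] by simp
  then have "good (r i) (r j) (r k) (r l)" if "i < j" "j < k" "k < l" for i j k l
    using t[OF that] by (metis zero_neq_one)
  then have "coherent (n \<circ> r) (c \<circ> r)" unfolding coherent_def good_def comp_def by blast
  then show ?thesis using that r(1) by blast
qed

text \<open>
  Asking for a subset of a member of \<open>\<S>\<^sub>k\<close>, rather than a member, makes the condition pass to
  subsets of \<open>t\<close>, which is needed to select the indices whose coefficients have a given sign.
\<close>

definition active :: "nat \<Rightarrow> nat \<Rightarrow> (nat \<times> nat \<Rightarrow> nat) \<Rightarrow> cantor \<Rightarrow> bool" where
  "active k n c t \<longleftrightarrow> t n \<and> (\<exists>G\<in>schreier k. Collect t \<inter> {..n} \<subseteq> G) \<and> separates (Collect t) n c"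

lemma four_increasing_elements:
  fixes X :: "nat set"
  assumes "finite X" "\<not> card X \<le> 3"
  obtains b0 b1 b2 b3 where "b0 \<in> X" "b1 \<in> X" "b2 \<in> X" "b3 \<in> X" "b0 < b1" "b1 < b2" "b2 < b3"
proof -
  let ?L = "sorted_list_of_set X"
  have len: "length ?L > 3" using assms by simp
  have "?L ! i \<in> X" if "i < length ?L" for i
    using nth_mem[OF that] assms(1) by simp
  moreover have "?L ! i < ?L ! j" if "i < j" "j < length ?L" for i j
    using sorted_wrt_nth_less[OF strict_sorted_list_of_set that] .
  ultimately show ?thesis
    using len by (intro that[of "?L ! 0" "?L ! 1" "?L ! 2" "?L ! 3"]) auto
qed

text \<open>
  Four indices of active functions among the first \<open>q\<close> elements of \<open>t\<close> from \<open>q\<close> on would contradict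
  coherence: the first of them is at least \<open>q\<close>, so the colouring of the last one gives the two in the
  middle the same colour from the palette of \<open>q\<close>, and then the last function is not active.
\<close>

lemma trace_thin:
  assumes n: "strict_mono n" and coh: "coherent n c" and A: "finite A"
  shows "n ` {i\<in>A. active (Suc k) (n i) (c i) t} \<in> thin k" (is "?B \<in> _")
proof (cases "?B = {}")
  case True
  show ?thesis unfolding True
    using locally_sparse_imp_thin[of "{}" k "{}" "{}"] by (simp add: locally_sparse_def schreier.simps(2))
next
  case False
  have finB: "finite ?B" using A by simp
  have "Max ?B \<in> ?B" using finB False by (rule Max_in)
  then obtain i where i: "Max ?B = n i" "active (Suc k) (n i) (c i) t" by auto
  then obtain G where G: "G \<in> schreier (Suc k)" "Collect t \<inter> {..Max ?B} \<subseteq> G"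
    unfolding active_def by auto
  let ?F = "Collect t \<inter> {..Max ?B}"
  have top: "b \<le> Max ?B" if "b \<in> ?B" for b using finB that by (rule Max_ge)
  have "?B \<subseteq> ?F" using top by (auto simp: active_def)
  moreover have "locally_sparse ?F ?B" unfolding locally_sparse_def
  proof (rule ballI, rule ccontr)
    fix q assume q: "q \<in> ?F"
    let ?X = "{b \<in> ?B. q \<le> b \<and> card (?F \<inter> {q..b}) \<le> q}"
    assume many: "\<not> card ?X \<le> 3"
    have finX: "finite ?X" using finB by simp
    obtain b0 b1 b2 b3 where b: "b0 \<in> ?X" "b1 \<in> ?X" "b2 \<in> ?X" "b3 \<in> ?X"
      "b0 < b1" "b1 < b2" "b2 < b3" by (rule four_increasing_elements[OF finX many])
    obtain i0 where i0: "b0 = n i0" using b(1) by blast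
    obtain i1 where i1: "b1 = n i1" "active (Suc k) (n i1) (c i1) t" using b(2) by blast
    obtain i2 where i2: "b2 = n i2" "active (Suc k) (n i2) (c i2) t" using b(3) by blast
    obtain i3 where i3: "b3 = n i3" "active (Suc k) (n i3) (c i3) t" using b(4) by blast
    have "i0 < i1" "i1 < i2" "i2 < i3"
      using b(5-7) n unfolding i0 i1 i2 i3 by (simp_all add: strict_mono_less)
    moreover have "q \<le> n i0" using b(1) i0 by simp
    ultimately have "c i3 (q, b1) = c i3 (q, b2)"
      using coh unfolding coherent_def i1 i2 by blast
    moreover have "c i3 (q, b1) \<noteq> c i3 (q, b2)"
    proof -
      have "?F \<inter> {q..b2} = Collect t \<inter> {q..b2}" using top[of b2] b(3) by auto
      then have "card (Collect t \<inter> {q..b2}) \<le> q" using b(3) by simp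
      moreover have "t q" "t b1" "t b2" "q < b1" "separates (Collect t) b3 (c i3)"
        using q i1 i2 i3 b(1,5) unfolding active_def by auto
      ultimately show ?thesis
        using b(6,7) unfolding separates_def by blast
    qed
    ultimately show False by blast
  qed
  ultimately show ?thesis using locally_sparse_imp_thin[OF G] by blast
qed
section \<open>Weakly null sequences without spreading models\<close>

lemma apply_bcontfun_sum: "apply_bcontfun (\<Sum>i\<in>A. f i) t = (\<Sum>i\<in>A. apply_bcontfun (f i) t)"
  by (induction A rule: infinite_finite_induct) auto

lemma weakly_converges_pointwise:
  fixes x :: "nat \<Rightarrow> ('a::topological_space \<Rightarrow>\<^sub>C 'k::real_normed_field)"
  assumes "weakly_converges bcont_scale x l"
  shows "(\<lambda>n. x n t) \<longlonglongrightarrow> l t"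
proof -
  have "bounded_linear (\<lambda>f :: 'a \<Rightarrow>\<^sub>C 'k. f t)"
    by (rule bounded_linear_intro[where K = 1]) (simp_all add: norm_bounded)
  then have "bounded_linear (\<lambda>f :: 'a \<Rightarrow>\<^sub>C 'k. f t) \<and> (\<forall>c v. bcont_scale c v t = c * apply_bcontfun v t)"
    by simp
  then show ?thesis
    by (rule assms[unfolded weakly_converges_def, rule_format, of "\<lambda>f. apply_bcontfun f t"])
qed

lemma k_weakly_converges_const:
  fixes v :: "'a::topological_space \<Rightarrow>\<^sub>C 'k::real_normed_field"
  shows "k_weakly_converges bcont_scale k (\<lambda>_. v) v"
proof -
  let ?S = "{norm (\<Sum>n\<in>E. bcont_scale (a n) (v - v)) | E (a :: nat \<Rightarrow> 'k).
     E \<in> schreier k \<and> (\<Sum>n\<in>E. norm (a n)) = 1}"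
  have z: "bcont_scale c (v - v) = 0" for c :: 'k
    by (rule bcontfun_eqI) simp
  have "0 \<in> ?S"
    unfolding z using singleton_schreier[of 1 k]
    by (intro CollectI exI[of _ "{1}"] exI[of _ "\<lambda>_. 1"]) simp
  moreover have "bdd_below ?S" by (rule bdd_belowI[of _ 0]) auto
  ultimately have "Inf ?S \<le> 0" by (rule cInf_lower)
  then show ?thesis
    unfolding k_weakly_converges_def weakly_converges_def l1_spreading_model_def by auto
qed

text \<open>
  The bound concerns the sum of absolute values, so it controls all combinations with
  coefficients of modulus \<open>a i\<close>. Taking them positive excludes spreading models. If weak
  convergence failed, some functional would be at least \<open>e\<close> in modulus along a subsequence,
  and coefficients that rotate its values to the positive axis would give it a value of at least
  \<open>e\<close> on a vector of small norm.
\<close>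

lemma k_weakly_null_criterion:
  fixes x :: "nat \<Rightarrow> ('a::topological_space \<Rightarrow>\<^sub>C 'k::real_normed_field)"
  assumes small: "\<And>r \<epsilon>. \<lbrakk>strict_mono (r :: nat \<Rightarrow> nat); \<epsilon> > 0\<rbrakk> \<Longrightarrow>
      \<exists>E (a :: nat \<Rightarrow> real). E \<in> schreier k \<and> (\<forall>i\<in>E. a i \<ge> 0) \<and> (\<Sum>i\<in>E. a i) = 1 \<and>
        (\<forall>t. (\<Sum>i\<in>E. a i * norm (x (r i) t)) \<le> \<epsilon>)"
  shows "k_weakly_converges bcont_scale k x 0"
proof -
  have bound: "norm (\<Sum>i\<in>E. bcont_scale (z i) (x (r i))) \<le> \<epsilon>"
    if "\<forall>t. (\<Sum>i\<in>E. a i * norm (x (r i) t)) \<le> \<epsilon>" "\<And>i. i \<in> E \<Longrightarrow> norm (z i) = a i"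
    for E r \<epsilon> and a :: "nat \<Rightarrow> real" and z :: "nat \<Rightarrow> 'k"
  proof (rule norm_bound)
    fix t
    have "norm (\<Sum>i\<in>E. z i * x (r i) t) \<le> (\<Sum>i\<in>E. norm (z i * x (r i) t))" by (rule norm_sum)
    also have "\<dots> = (\<Sum>i\<in>E. a i * norm (x (r i) t))"
      using that(2) by (intro sum.cong) (auto simp: norm_mult)
    also have "\<dots> \<le> \<epsilon>" using that(1) by blast
    finally show "norm (apply_bcontfun (\<Sum>i\<in>E. bcont_scale (z i) (x (r i))) t) \<le> \<epsilon>"
      by (simp add: apply_bcontfun_sum)
  qed
  have "weakly_converges bcont_scale x 0"
    unfolding weakly_converges_def
  proof (intro allI impI, elim conjE)
    fix f :: "('a \<Rightarrow>\<^sub>C 'k) \<Rightarrow> 'k"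
    assume f: "bounded_linear f" and hom: "\<forall>c v. f (bcont_scale c v) = c * f v"
    interpret f: bounded_linear f by fact
    obtain B where B: "B > 0" "\<And>v. norm (f v) \<le> norm v * B" using f.pos_bounded by blast
    show "(\<lambda>n. f (x n)) \<longlonglongrightarrow> f 0"
    proof (rule ccontr)
      assume "\<not> ?thesis"
      then obtain e where e: "e > 0" "\<forall>N. \<exists>n\<ge>N. norm (f (x n)) \<ge> e"
        unfolding f.zero LIMSEQ_iff by (auto simp: not_less)
      then have "infinite {n. norm (f (x n)) \<ge> e}"
        unfolding infinite_nat_iff_unbounded_le by auto
      then obtain r :: "nat \<Rightarrow> nat" where r: "strict_mono r" "\<And>n. norm (f (x (r n))) \<ge> e"
        using infinite_enumerate by blast
      have "e / (2 * B) > 0" using e B by simp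
      then obtain E and a :: "nat \<Rightarrow> real" where E: "\<forall>i\<in>E. a i \<ge> 0" "(\<Sum>i\<in>E. a i) = 1"
        "\<forall>t. (\<Sum>i\<in>E. a i * norm (x (r i) t)) \<le> e / (2 * B)"
        using small[OF r(1)] by blast
      define z where "z i = of_real (a i * norm (f (x (r i)))) / f (x (r i))" for i
      have nz: "f (x (r i)) \<noteq> 0" for i using r(2)[of i] e(1) by auto
      have "norm (z i) = a i" if "i \<in> E" for i
        using that E(1) nz by (simp add: z_def norm_divide norm_mult)
      then have le: "norm (\<Sum>i\<in>E. bcont_scale (z i) (x (r i))) \<le> e / (2 * B)"
        using bound[OF E(3)] by blast
      have "f (\<Sum>i\<in>E. bcont_scale (z i) (x (r i))) = (\<Sum>i\<in>E. of_real (a i * norm (f (x (r i)))))"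
        using nz hom by (simp add: f.sum z_def)
      also have "\<dots> = of_real (\<Sum>i\<in>E. a i * norm (f (x (r i))))" by simp
      finally have "norm (f (\<Sum>i\<in>E. bcont_scale (z i) (x (r i)))) = \<bar>\<Sum>i\<in>E. a i * norm (f (x (r i)))\<bar>"
        by (simp only: norm_of_real)
      also have "\<dots> \<ge> (\<Sum>i\<in>E. a i * e)"
      proof -
        have "(\<Sum>i\<in>E. a i * e) \<le> (\<Sum>i\<in>E. a i * norm (f (x (r i))))"
          using E(1) r(2) by (intro sum_mono mult_left_mono) auto
        then show ?thesis by linarith
      qed
      finally have "e \<le> norm (f (\<Sum>i\<in>E. bcont_scale (z i) (x (r i))))"
        using E(2) by (simp add: sum_distrib_right[symmetric])
      also have "\<dots> \<le> norm (\<Sum>i\<in>E. bcont_scale (z i) (x (r i))) * B" by (rule B)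
      also have "\<dots> \<le> e / (2 * B) * B" using le B by (intro mult_right_mono) auto
      also have "\<dots> = e / 2" using B by simp
      finally show False using e(1) by simp
    qed
  qed
  moreover have "\<not> l1_spreading_model bcont_scale k (\<lambda>n. x (r n) - 0)" if r: "strict_mono r" for r
  proof
    let ?S = "{norm (\<Sum>n\<in>E. bcont_scale (a n) (x (r n) - 0)) | E (a :: nat \<Rightarrow> 'k).
     E \<in> schreier k \<and> (\<Sum>n\<in>E. norm (a n)) = 1}"
    assume "l1_spreading_model bcont_scale k (\<lambda>n. x (r n) - 0)"
    then have pos: "0 < Inf ?S" unfolding l1_spreading_model_def .
    then have "Inf ?S / 2 > 0" by simp
    from small[OF r this] obtain E and a :: "nat \<Rightarrow> real" where E: "E \<in> schreier k"
      "\<forall>i\<in>E. a i \<ge> 0" "(\<Sum>i\<in>E. a i) = 1" "\<forall>t. (\<Sum>i\<in>E. a i * norm (x (r i) t)) \<le> Inf ?S / 2"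
      by blast
    have le: "norm (\<Sum>i\<in>E. bcont_scale (of_real (a i) :: 'k) (x (r i))) \<le> Inf ?S / 2"
      by (rule bound[OF E(4)]) (use E(2) in simp)
    have "(\<Sum>n\<in>E. norm (of_real (a n) :: 'k)) = (\<Sum>n\<in>E. a n)"
      using E(2) by (intro sum.cong) auto
    then have "norm (\<Sum>i\<in>E. bcont_scale (of_real (a i) :: 'k) (x (r i) - 0)) \<in> ?S"
      using E(1,3) by (intro CollectI exI[of _ E] exI[of _ "\<lambda>i. of_real (a i)"]) simp
    moreover have "bdd_below ?S" by (rule bdd_belowI[of _ 0]) auto
    ultimately have "Inf ?S \<le> norm (\<Sum>i\<in>E. bcont_scale (of_real (a i) :: 'k) (x (r i) - 0))"
      by (rule cInf_lower)
    then show False using le pos by simp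
  qed
  ultimately show ?thesis unfolding k_weakly_converges_def by blast
qed

section \<open>Indicator functions\<close>

lemma continuous_on_finitely_many_coordinates:
  fixes g :: "cantor \<Rightarrow> 'b::topological_space"
  assumes "\<And>t t'. (\<And>i. i \<le> n \<Longrightarrow> t i = t' i) \<Longrightarrow> g t = g t'"
  shows "continuous_on UNIV g"
  unfolding continuous_on_open_vimage[OF open_UNIV]
proof (intro allI impI)
  fix B :: "'b set"
  have "open {t' :: cantor. \<forall>i\<in>{..n}. t' i = t i}" for t :: cantor
  proof -
    have "open ((\<lambda>t' :: cantor. t' i) -` {t i})" for i
      by (rule open_vimage[OF open_discrete continuous_on_product_coordinates])
    then have "open (\<Inter>i\<in>{..n}. (\<lambda>t' :: cantor. t' i) -` {t i})" by (intro open_INT) auto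
    moreover have "(\<Inter>i\<in>{..n}. (\<lambda>t' :: cantor. t' i) -` {t i}) = {t'. \<forall>i\<in>{..n}. t' i = t i}" by auto
    ultimately show ?thesis by simp
  qed
  then have "open (\<Union>t\<in>g -` B. {t' :: cantor. \<forall>i\<in>{..n}. t' i = t i})" by blast
  moreover have "(\<Union>t\<in>g -` B. {t' :: cantor. \<forall>i\<in>{..n}. t' i = t i}) = g -` B \<inter> UNIV"
  proof -
    have "g t' = g t" if "\<forall>i\<in>{..n}. t' i = t i" for t t' by (rule assms) (use that in simp)
    note eq = this
    show ?thesis
    proof (intro equalityI subsetI)
      fix t' assume "t' \<in> (\<Union>t\<in>g -` B. {t' :: cantor. \<forall>i\<in>{..n}. t' i = t i})"
      then obtain t where "g t \<in> B" "\<forall>i\<in>{..n}. t' i = t i" by auto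
      then show "t' \<in> g -` B \<inter> UNIV" using eq[of t' t] by simp
    next
      fix t assume "t \<in> g -` B \<inter> UNIV"
      then show "t \<in> (\<Union>t\<in>g -` B. {t' :: cantor. \<forall>i\<in>{..n}. t' i = t i})"
        by (intro UN_I[of t]) simp_all
    qed
  qed
  ultimately show "open (g -` B \<inter> UNIV)" by simp
qed

lemma active_cong:
  assumes "\<And>i. i \<le> n \<Longrightarrow> t i = t' i"
  shows "active k n c t \<longleftrightarrow> active k n c t'"
proof -
  have "Collect t \<inter> {..n} = Collect t' \<inter> {..n}" using assms by auto
  moreover have "Collect t \<inter> {q..j} = Collect t' \<inter> {q..j}" if "j < n" for q j
    using assms that by auto
  moreover have "separates (Collect t) n c \<longleftrightarrow> separates (Collect t') n c"
  proof -
    have "separates F n c \<longleftrightarrow> separates (F \<inter> {..n}) n c" for F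
    proof -
      have "F \<inter> {..n} \<inter> {q..j} = F \<inter> {q..j}" if "j < n" for q j using that by auto
      then have "card (F \<inter> {..n} \<inter> {q..j}) = card (F \<inter> {q..j})" if "j < n" for q j using that by simp
      then show ?thesis unfolding separates_def by (auto 0 3)
    qed
    then show ?thesis using calculation(1) by metis
  qed
  ultimately show ?thesis using assms unfolding active_def by simp
qed

definition basic :: "nat \<Rightarrow> nat \<Rightarrow> (nat \<times> nat \<Rightarrow> nat) \<Rightarrow> (cantor \<Rightarrow>\<^sub>C 'k::real_normed_field)" where
  "basic k n c = Bcontfun (\<lambda>t. of_bool (active k n c t))"

lemma apply_basic [simp]: "apply_bcontfun (basic k n c) t = of_bool (active k n c t)"
proof -
  have "(\<lambda>t. of_bool (active k n c t) :: 'a) \<in> bcontfun"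
    unfolding continuous_cantor_bcontfun
  proof (rule continuous_on_finitely_many_coordinates[of n])
    fix t t' :: cantor assume "\<And>i. i \<le> n \<Longrightarrow> t i = t' i"
    then have "active k n c t = active k n c t'" by (rule active_cong)
    then show "(of_bool (active k n c t) :: 'a) = of_bool (active k n c t')" by simp
  qed
  then show ?thesis by (simp add: basic_def Bcontfun_inverse)
qed

text \<open>
  At each point the active functions have thin index set, so an average that gives
  little mass to thin sets is small at every point.
\<close>

lemma coherent_basic_k_weakly_null:
  assumes k: "k \<ge> 1" and n: "strict_mono n" and coh: "coherent n c"
  shows "k_weakly_converges bcont_scale k (\<lambda>i. basic k (n i) (c i) :: cantor \<Rightarrow>\<^sub>C 'k::real_normed_field) 0"
proof (rule k_weakly_null_criterion)
  fix r :: "nat \<Rightarrow> nat" and \<epsilon> :: real assume r: "strict_mono r" and \<epsilon>: "\<epsilon> > 0"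
  obtain j where j: "k = Suc j" using k by (cases k) auto
  have nr: "strict_mono (n \<circ> r)" using n r by (rule strict_mono_o)
  obtain E and a :: "nat \<Rightarrow> real" where E: "E \<in> schreier (Suc j)" "\<forall>i\<in>E. a i \<ge> 0"
    "(\<Sum>i\<in>E. a i) = 1" "\<forall>B\<in>thin j. (\<Sum>i | i \<in> E \<and> (n \<circ> r) i \<in> B. a i) \<le> \<epsilon>"
    using thin_invisible_average[OF nr \<epsilon>, of j 0] by blast
  have fin: "finite E" using E(1) schreier_finite_pos by blast
  have "(\<Sum>i\<in>E. a i * norm (basic k (n (r i)) (c (r i)) t :: 'k)) \<le> \<epsilon>" for t
  proof -
    let ?B = "n ` {i\<in>r ` E. active (Suc j) (n i) (c i) t}"
    have eq: "{i. i \<in> E \<and> (n \<circ> r) i \<in> ?B} = {i \<in> E. active k (n (r i)) (c (r i)) t}"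
      using n r unfolding j by (auto simp: strict_mono_eq)
    have "?B \<in> thin j" using fin by (intro trace_thin[OF n coh]) simp
    with E(4) have "(\<Sum>i | i \<in> E \<and> (n \<circ> r) i \<in> ?B. a i) \<le> \<epsilon>" by (rule bspec)
    then have "(\<Sum>i | i \<in> E \<and> active k (n (r i)) (c (r i)) t. a i) \<le> \<epsilon>" unfolding eq .
    moreover have "(\<Sum>i\<in>E. a i * norm (basic k (n (r i)) (c (r i)) t :: 'k))
        = (\<Sum>i | i \<in> E \<and> active k (n (r i)) (c (r i)) t. a i)"
      using fin by (intro sum.mono_neutral_cong_right) auto
    ultimately show ?thesis by simp
  qed
  then show "\<exists>E (a :: nat \<Rightarrow> real). E \<in> schreier k \<and> (\<forall>i\<in>E. a i \<ge> 0) \<and> (\<Sum>i\<in>E. a i) = 1 \<and>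
        (\<forall>t. (\<Sum>i\<in>E. a i * norm (basic k (n (r i)) (c (r i)) t :: 'k)) \<le> \<epsilon>)"
    using E(1-3) unfolding j by blast
qed

section \<open>A \<open>k\<close>-weakly compact set\<close>

lemma subsequence_constant_or_strict_mono:
  fixes g :: "nat \<Rightarrow> nat"
  obtains (const) r v where "strict_mono (r :: nat \<Rightarrow> nat)" "\<And>i. g (r i) = v"
  | (increasing) r where "strict_mono (r :: nat \<Rightarrow> nat)" "strict_mono (g \<circ> r)"
proof (cases "\<exists>v. infinite {i. g i = v}")
  case True
  then obtain v where "infinite {i. g i = v}" by blast
  then obtain r :: "nat \<Rightarrow> nat" where "strict_mono r" "\<And>i. r i \<in> {i. g i = v}"
    using infinite_enumerate by blast
  then show ?thesis using const by auto
next
  case False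
  have "\<exists>K. \<forall>i\<ge>K. m < g i" for m
  proof -
    have "{i. g i \<le> m} = (\<Union>v\<in>{..m}. {i. g i = v})" by auto
    then have "finite {i. g i \<le> m}" using False by simp
    then obtain K where "\<forall>i\<in>{i. g i \<le> m}. i < K" using finite_nat_set_iff_bounded by blast
    then have "\<forall>i\<ge>K. m < g i" by (auto simp: not_le[symmetric])
    then show ?thesis by blast
  qed
  then obtain K where K: "\<And>m i. i \<ge> K m \<Longrightarrow> m < g i" by metis
  define s where "s = rec_nat 0 (\<lambda>_ s. max (Suc s) (K (g s)))"
  have s: "s (Suc j) = max (Suc (s j)) (K (g (s j)))" for j by (simp add: s_def)
  have "strict_mono s" by (simp add: strict_mono_Suc_iff s less_max_iff_disj)
  moreover have "strict_mono (g \<circ> s)" using K unfolding strict_mono_Suc_iff comp_def s by (intro allI K) simp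
  ultimately show ?thesis by (rule increasing)
qed

definition basics :: "nat \<Rightarrow> (cantor \<Rightarrow>\<^sub>C 'k::real_normed_field) set" where
  "basics k = {basic k n c | n c. c \<in> colourings n}"

text \<open>
  No member of a Schreier family contains \<open>0\<close>, so the functions with index \<open>0\<close> vanish.
\<close>

lemma zero_in_basics: "0 \<in> basics k"
proof -
  obtain c where c: "c \<in> colourings 0" using card_colourings_pos[of 0] by fastforce
  have "\<not> active k 0 c t" for t
    using schreier_finite_pos[of _ k] unfolding active_def by fastforce
  then have "basic k 0 c = 0" by (intro bcontfun_eqI) simp
  then show ?thesis
    unfolding basics_def using c by (intro CollectI exI[of _ "0::nat"] exI[of _ c]) simp
qed

text \<open>
  For each index there are only finitely many functions. Hence a sequence in the set
  has either a constant subsequence or one with strictly increasing indices, and the latter can be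
  made coherent.
\<close>

lemma k_weakly_compact_basics:
  assumes "k \<ge> 1"
  shows "k_weakly_compact bcont_scale k (basics k :: (cantor \<Rightarrow>\<^sub>C 'k::real_normed_field) set)"
  unfolding k_weakly_compact_def
proof (intro allI impI)
  fix x :: "nat \<Rightarrow> (cantor \<Rightarrow>\<^sub>C 'k)" assume x: "\<forall>n\<ge>1. x n \<in> basics k"
  have "\<exists>p. snd p \<in> colourings (fst p) \<and> x (Suc i) = basic k (fst p) (snd p)" for i
  proof -
    have "x (Suc i) \<in> basics k" using x by simp
    then obtain n c where "c \<in> colourings n" "x (Suc i) = basic k n c" unfolding basics_def by blast
    then show ?thesis by (intro exI[of _ "(n, c)"]) simp
  qed
  then obtain p where p: "\<And>i. snd (p i) \<in> colourings (fst (p i))"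
    "\<And>i. x (Suc i) = basic k (fst (p i)) (snd (p i))" by metis
  define n c where "n i = fst (p i)" and "c i = snd (p i)" for i
  have nc: "c i \<in> colourings (n i)" "x (Suc i) = basic k (n i) (c i)" for i
    using p by (simp_all add: n_def c_def)
  have Suc_mono: "strict_mono Suc" by (simp add: strict_mono_Suc_iff)
  show "\<exists>r l. strict_mono (r :: nat \<Rightarrow> nat) \<and> l \<in> basics k \<and> k_weakly_converges bcont_scale k (x \<circ> r) l"
  proof (cases rule: subsequence_constant_or_strict_mono[of n])
    case (const r v)
    have "c (r i) \<in> colourings v" for i using nc(1)[of "r i"] const(2)[of i] by simp
    then have "(c \<circ> r) ` UNIV \<subseteq> colourings v" by auto
    then have "finite ((c \<circ> r) ` UNIV)" using finite_colourings finite_subset by blast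
    then obtain i0 where "infinite {i \<in> UNIV. (c \<circ> r) i = (c \<circ> r) i0}"
      using pigeonhole_infinite[OF infinite_UNIV_nat] by blast
    then obtain s :: "nat \<Rightarrow> nat" where s: "strict_mono s" "\<And>i. c (r (s i)) = c (r i0)"
      using infinite_enumerate[of "{i \<in> UNIV. (c \<circ> r) i = (c \<circ> r) i0}"] by auto
    have "x \<circ> (Suc \<circ> r \<circ> s) = (\<lambda>_. basic k v (c (r i0)))"
      using nc(2) const(2) s(2) by auto
    then have "k_weakly_converges bcont_scale k (x \<circ> (Suc \<circ> r \<circ> s)) (basic k v (c (r i0)))"
      by (simp add: k_weakly_converges_const)
    moreover have "basic k v (c (r i0)) \<in> basics k"
      unfolding basics_def using nc(1)[of "r i0"] const(2)[of i0] by blast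
    moreover have "strict_mono (Suc \<circ> r \<circ> s)"
      using Suc_mono const(1) s(1) by (intro strict_mono_o)
    ultimately show ?thesis by blast
  next
    case (increasing r)
    obtain s :: "nat \<Rightarrow> nat" where s: "strict_mono s" "coherent (n \<circ> r \<circ> s) (c \<circ> r \<circ> s)"
      using coherent_subsequence[OF increasing(2), of "c \<circ> r"] nc(1) by auto
    have "k_weakly_converges bcont_scale k
        (\<lambda>i. basic k ((n \<circ> r \<circ> s) i) ((c \<circ> r \<circ> s) i) :: cantor \<Rightarrow>\<^sub>C 'k) 0"
      using strict_mono_o[OF increasing(2) s(1)] s(2) assms by (intro coherent_basic_k_weakly_null)
    then have "k_weakly_converges bcont_scale k (x \<circ> (Suc \<circ> r \<circ> s)) 0"
      using nc(2) by (simp add: comp_def)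
    moreover have "strict_mono (Suc \<circ> r \<circ> s)"
      using Suc_mono increasing(1) s(1) by (intro strict_mono_o)
    ultimately show ?thesis using zero_in_basics by blast
  qed
qed
section \<open>Averages over all colourings\<close>

definition average :: "nat \<Rightarrow> nat \<Rightarrow> (cantor \<Rightarrow>\<^sub>C 'k::real_normed_field)" where
  "average k n = (\<Sum>c\<in>colourings n. (1 / real (card (colourings n))) *\<^sub>R basic k n c)"

definition weight :: "nat \<Rightarrow> nat \<Rightarrow> cantor \<Rightarrow> real" where
  "weight k n t = card {c \<in> colourings n. active k n c t} / card (colourings n)"

lemma apply_average: "apply_bcontfun (average k n) t = of_real (weight k n t)"
proof -
  have "(\<Sum>c\<in>colourings n. of_bool (active k n c t)) = (of_nat (card {c \<in> colourings n. active k n c t}) :: 'a)"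
    using finite_colourings[of n] by (simp add: Int_def)
  then have "(\<Sum>c\<in>colourings n. (1 / real (card (colourings n))) *\<^sub>R (of_bool (active k n c t) :: 'a))
      = (1 / real (card (colourings n))) *\<^sub>R of_nat (card {c \<in> colourings n. active k n c t})"
    unfolding scaleR_sum_right[symmetric] by simp
  then show ?thesis
    by (simp add: average_def weight_def apply_bcontfun_sum scaleR_conv_of_real)
qed

lemma weight_eq_0: "\<not> t n \<Longrightarrow> weight k n t = 0"
  by (simp add: weight_def active_def)

lemma weight_ge_half:
  assumes "E \<in> schreier k" "F \<subseteq> E" "n \<in> F"
  shows "1 / 2 \<le> weight k n (\<lambda>m. m \<in> F)"
proof -
  have "{c \<in> colourings n. active k n c (\<lambda>m. m \<in> F)} = {c \<in> colourings n. separates F n c}"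
    using assms unfolding active_def by auto
  then show ?thesis
    using half_of_colourings_separate[of n F] card_colourings_pos[of n]
    by (simp add: weight_def field_simps)
qed

lemma average_in_convex:
  assumes "convex V" "\<And>c. c \<in> colourings n \<Longrightarrow> basic k n c \<in> V"
  shows "average k n \<in> V"
  unfolding average_def
  by (rule convex_sum[OF finite_colourings assms(1)]) (use assms(2) card_colourings_pos[of n] in auto)

text \<open>
  Real-linear functionals whose positive parts dominate the norm. They give the real and the
  complex scalars a common treatment of signs: for any finite family of coefficients, the
  positive part of one of the functionals captures a fixed proportion of the total mass.
\<close>

definition norming :: "('k::real_normed_field \<Rightarrow> real) set \<Rightarrow> bool" where
  "norming \<Phi> \<longleftrightarrow> finite \<Phi> \<and> (\<forall>\<phi>\<in>\<Phi>. linear \<phi> \<and> (\<forall>z. \<phi> z \<le> norm z)) \<and>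
     (\<forall>z. norm z \<le> (\<Sum>\<phi>\<in>\<Phi>. max 0 (\<phi> z)))"

text \<open>
  Given coefficients on a member of \<open>\<S>\<^sub>k\<close>, some functional \<open>\<phi>\<close> has positive part at least
  \<open>1 / card \<Phi>\<close> on them in total. Evaluate at the point \<open>t\<close> that consists of the indices with
  positive \<open>\<phi>\<close>-value: those averages are at least one half there, and all others vanish.
\<close>

lemma averages_spreading_model:
  fixes \<Phi> :: "('k::real_normed_field \<Rightarrow> real) set"
  assumes \<Phi>: "norming \<Phi>" and r: "strict_mono r"
  shows "l1_spreading_model bcont_scale k (\<lambda>n. average k (r n) :: cantor \<Rightarrow>\<^sub>C 'k)"
proof -
  let ?S = "{norm (\<Sum>n\<in>E. bcont_scale (a n) (average k (r n) :: cantor \<Rightarrow>\<^sub>C 'k)) | E (a :: nat \<Rightarrow> 'k).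
     E \<in> schreier k \<and> (\<Sum>n\<in>E. norm (a n)) = 1}"
  have fin: "finite \<Phi>" and lin: "\<And>\<phi>. \<phi> \<in> \<Phi> \<Longrightarrow> linear \<phi>" and le: "\<And>\<phi> z. \<phi> \<in> \<Phi> \<Longrightarrow> \<phi> z \<le> norm z"
    and ge: "\<And>z. norm z \<le> (\<Sum>\<phi>\<in>\<Phi>. max 0 (\<phi> z))"
    using \<Phi> unfolding norming_def by auto
  have "\<Phi> \<noteq> {}" using ge[of 1] by auto
  then have card: "real (card \<Phi>) > 0" using fin by (simp add: card_gt_0_iff)
  have lower: "1 / (2 * card \<Phi>) \<le> norm (\<Sum>n\<in>E. bcont_scale (a n) (average k (r n) :: cantor \<Rightarrow>\<^sub>C 'k))"
    if E: "E \<in> schreier k" and a: "(\<Sum>n\<in>E. norm (a n)) = 1" for E and a :: "nat \<Rightarrow> 'k"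
  proof -
    have finE: "finite E" using E schreier_finite_pos by blast
    have "\<exists>\<phi>\<in>\<Phi>. 1 / card \<Phi> \<le> (\<Sum>n\<in>E. max 0 (\<phi> (a n)))"
    proof (rule ccontr)
      assume "\<not> ?thesis"
      then have "(\<Sum>\<phi>\<in>\<Phi>. \<Sum>n\<in>E. max 0 (\<phi> (a n))) < (\<Sum>\<phi>\<in>\<Phi>. 1 / card \<Phi>)"
        using fin \<open>\<Phi> \<noteq> {}\<close> by (intro sum_strict_mono) (auto simp: not_le)
      also have "\<dots> = 1" using card by simp
      finally have "(\<Sum>n\<in>E. \<Sum>\<phi>\<in>\<Phi>. max 0 (\<phi> (a n))) < 1" by (subst sum.swap)
      moreover have "(\<Sum>n\<in>E. norm (a n)) \<le> (\<Sum>n\<in>E. \<Sum>\<phi>\<in>\<Phi>. max 0 (\<phi> (a n)))"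
        by (intro sum_mono ge)
      ultimately show False using a by simp
    qed
    then obtain \<phi> where \<phi>: "\<phi> \<in> \<Phi>" "1 / card \<Phi> \<le> (\<Sum>n\<in>E. max 0 (\<phi> (a n)))" by blast
    interpret \<phi>: linear \<phi> using lin \<phi>(1) .
    define F where "F = r ` {n\<in>E. \<phi> (a n) > 0}"
    define t where "t = (\<lambda>m. m \<in> F)"
    have sub: "F \<subseteq> r ` E" unfolding F_def by blast
    have summand: "max 0 (\<phi> (a n)) / 2 \<le> \<phi> (a n * of_real (weight k (r n) t))" if n: "n \<in> E" for n
    proof -
      have "a n * of_real (weight k (r n) t) = weight k (r n) t *\<^sub>R a n"
        by (simp add: scaleR_conv_of_real)
      then have eq: "\<phi> (a n * of_real (weight k (r n) t)) = weight k (r n) t * \<phi> (a n)"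
        by (simp add: \<phi>.scale)
      show ?thesis
      proof (cases "\<phi> (a n) > 0")
        case True
        then have "r n \<in> F" using n unfolding F_def by blast
        then have "1 / 2 \<le> weight k (r n) t"
          unfolding t_def by (rule weight_ge_half[OF schreier_spreading[OF r E] sub])
        then have "1 / 2 * \<phi> (a n) \<le> weight k (r n) t * \<phi> (a n)"
          using True by (intro mult_right_mono) auto
        then show ?thesis using True eq by simp
      next
        case False
        then have "r n \<notin> F" using r unfolding F_def by (auto simp: strict_mono_eq)
        then have "weight k (r n) t = 0" unfolding t_def by (intro weight_eq_0) simp
        then show ?thesis using False eq by simp
      qed
    qed
    have "1 / (2 * card \<Phi>) \<le> (\<Sum>n\<in>E. max 0 (\<phi> (a n))) / 2"
      using \<phi>(2) by simp
    also have "\<dots> \<le> (\<Sum>n\<in>E. \<phi> (a n * of_real (weight k (r n) t)))"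
      unfolding sum_divide_distrib by (intro sum_mono summand)
    also have "\<dots> = \<phi> (\<Sum>n\<in>E. a n * of_real (weight k (r n) t))" by (simp add: \<phi>.sum)
    also have "\<dots> \<le> norm (\<Sum>n\<in>E. a n * of_real (weight k (r n) t))" by (rule le[OF \<phi>(1)])
    also have "\<dots> = norm (apply_bcontfun (\<Sum>n\<in>E. bcont_scale (a n) (average k (r n) :: cantor \<Rightarrow>\<^sub>C 'k)) t)"
      by (simp add: apply_bcontfun_sum apply_average)
    also have "\<dots> \<le> norm (\<Sum>n\<in>E. bcont_scale (a n) (average k (r n) :: cantor \<Rightarrow>\<^sub>C 'k))"
      by (rule norm_bounded)
    finally show ?thesis .
  qed
  have "?S \<noteq> {}"
  proof -
    have "norm (\<Sum>n\<in>{1}. bcont_scale ((\<lambda>_. 1) n) (average k (r n) :: cantor \<Rightarrow>\<^sub>C 'k)) \<in> ?S"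
      using singleton_schreier[of 1 k]
      by (intro CollectI exI[of _ "{1}"] exI[of _ "\<lambda>_. 1"]) simp
    then show ?thesis by blast
  qed
  then have "1 / (2 * card \<Phi>) \<le> Inf ?S"
    by (rule cInf_greatest) (use lower in blast)
  moreover have "0 < 1 / real (2 * card \<Phi>)" using card by simp
  ultimately show ?thesis unfolding l1_spreading_model_def by (rule less_le_trans[rotated])
qed

lemma finite_points_dense:
  fixes l :: "cantor \<Rightarrow>\<^sub>C 'k::real_normed_field"
  assumes "\<And>t. finite (Collect t) \<Longrightarrow> l t = 0"
  shows "l = 0"
proof (rule bcontfun_eqI)
  fix t :: cantor
  define u where "u m = (\<lambda>i. t i \<and> i \<le> m)" for m :: nat
  have "limitin (product_topology (\<lambda>_. euclidean) UNIV) u t sequentially"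
    unfolding limitin_componentwise
  proof (intro conjI ballI)
    fix i :: nat
    have "\<forall>\<^sub>F m in sequentially. u m i = t i"
      using eventually_ge_at_top[of i] by eventually_elim (simp add: u_def)
    then have "(\<lambda>m. u m i) \<longlonglongrightarrow> t i" by (rule tendsto_eventually)
    then show "limitin euclidean (\<lambda>m. u m i) (t i) sequentially" by simp
  qed simp_all
  then have "u \<longlonglongrightarrow> t" by (simp add: euclidean_product_topology)
  then have "(\<lambda>m. l (u m)) \<longlonglongrightarrow> l t"
    using continuous_on_tendsto_compose[OF continuous_on_apply_bcontfun[of UNIV l]] by simp
  moreover have "l (u m) = 0" for m
    by (rule assms) (simp add: u_def)
  ultimately show "l t = apply_bcontfun 0 t" by (simp add: LIMSEQ_const_iff)
qed

text \<open>
  The averages vanish eventually at each finite set, which leaves \<open>0\<close> as the only possible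
  limit, and a spreading model cannot converge \<open>k\<close>-weakly to \<open>0\<close>.
\<close>

lemma averages_not_k_weakly_convergent:
  fixes \<Phi> :: "('k::real_normed_field \<Rightarrow> real) set"
  assumes \<Phi>: "norming \<Phi>" and r: "strict_mono r"
  shows "\<not> k_weakly_converges bcont_scale k (\<lambda>i. average k (r i) :: cantor \<Rightarrow>\<^sub>C 'k) l"
proof
  assume conv: "k_weakly_converges bcont_scale k (\<lambda>i. average k (r i) :: cantor \<Rightarrow>\<^sub>C 'k) l"
  then have weak: "weakly_converges bcont_scale (\<lambda>i. average k (r i) :: cantor \<Rightarrow>\<^sub>C 'k) l"
    unfolding k_weakly_converges_def by blast
  have "l = 0"
  proof (rule finite_points_dense)
    fix t :: cantor assume "finite (Collect t)"
    then obtain N where N: "\<forall>i\<in>Collect t. i < N" using finite_nat_set_iff_bounded by blast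
    have "\<forall>\<^sub>F i in sequentially. apply_bcontfun (average k (r i)) t = (0 :: 'k)"
      using eventually_ge_at_top[of N]
    proof eventually_elim
      case (elim i)
      then have "\<not> t (r i)" using N strict_mono_imp_increasing[OF r, of i] by fastforce
      then show ?case by (simp add: apply_average weight_eq_0)
    qed
    then have "(\<lambda>i. apply_bcontfun (average k (r i)) t) \<longlonglongrightarrow> (0 :: 'k)" by (rule tendsto_eventually)
    then show "l t = 0"
      using weakly_converges_pointwise[OF weak] LIMSEQ_unique by blast
  qed
  moreover have "strict_mono (\<lambda>n :: nat. n)" by (simp add: strict_mono_def)
  ultimately show False
    using conv averages_spreading_model[OF \<Phi> r, of k] unfolding k_weakly_converges_def by auto
qed

section \<open>Failure of compactness for the hull and of local convexity\<close>

lemma closed_convex_hull_not_k_weakly_compact: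
  fixes \<Phi> :: "('k::real_normed_field \<Rightarrow> real) set"
  assumes "norming \<Phi>"
  shows "\<not> k_weakly_compact bcont_scale k (closure (convex hull (basics k :: (cantor \<Rightarrow>\<^sub>C 'k) set)))"
proof
  assume compact: "k_weakly_compact bcont_scale k (closure (convex hull (basics k :: (cantor \<Rightarrow>\<^sub>C 'k) set)))"
  have "average k n \<in> convex hull (basics k :: (cantor \<Rightarrow>\<^sub>C 'k) set)" for n
    by (intro average_in_convex convex_convex_hull hull_inc) (auto simp: basics_def)
  then have "\<forall>n\<ge>1. average k n \<in> closure (convex hull (basics k :: (cantor \<Rightarrow>\<^sub>C 'k) set))"
    using closure_subset by blast
  then obtain r l where "strict_mono r" "k_weakly_converges bcont_scale k (average k \<circ> r) (l :: cantor \<Rightarrow>\<^sub>C 'k)"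
    using compact unfolding k_weakly_compact_def by blast
  then show False
    using averages_not_k_weakly_convergent[OF assms] by (simp add: comp_def)
qed

text \<open>
  A \<open>k\<close>-weakly convergent sequence of averages cannot have unbounded indices, so it has a
  constant subsequence.
\<close>

lemma k_closed_averages:
  fixes \<Phi> :: "('k::real_normed_field \<Rightarrow> real) set"
  assumes \<Phi>: "norming \<Phi>"
  shows "k_closed bcont_scale k (average k ` {1..} :: (cantor \<Rightarrow>\<^sub>C 'k) set)"
  unfolding k_closed_def
proof (intro allI impI, elim conjE)
  fix x :: "nat \<Rightarrow> (cantor \<Rightarrow>\<^sub>C 'k)" and l
  assume x: "\<forall>n\<ge>1. x n \<in> average k ` {1..}" and conv: "k_weakly_converges bcont_scale k x l"
  have "\<exists>m\<ge>1. x (Suc i) = average k m" for i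
  proof -
    have "x (Suc i) \<in> average k ` {1..}" using x by simp
    then show ?thesis by auto
  qed
  then obtain g where g: "\<And>i. g i \<ge> 1" "\<And>i. x (Suc i) = average k (g i)" by metis
  have sub: "k_weakly_converges bcont_scale k (\<lambda>i. average k (g (r i))) l" if r: "strict_mono r" for r
  proof -
    have "strict_mono (Suc \<circ> r)" using r by (simp add: strict_mono_def)
    from k_weakly_converges_subseq[OF conv this] show ?thesis by (simp add: comp_def g(2))
  qed
  show "l \<in> average k ` {1..}"
  proof (cases rule: subsequence_constant_or_strict_mono[of g])
    case (const r v)
    have "k_weakly_converges bcont_scale k (\<lambda>_. average k v) l" using sub[OF const(1)] const(2) by simp
    then have "weakly_converges bcont_scale (\<lambda>_. average k v) l" unfolding k_weakly_converges_def by blast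
    from weakly_converges_pointwise[OF this] have "l = average k v"
      by (intro bcontfun_eqI) (simp add: LIMSEQ_const_iff)
    moreover have "v \<ge> 1" using g(1)[of "r 0"] const(2)[of 0] by simp
    ultimately show ?thesis by simp
  next
    case (increasing r)
    then show ?thesis
      using averages_not_k_weakly_convergent[OF \<Phi> increasing(2)] sub[OF increasing(1)] by simp
  qed
qed

text \<open>
  A \<open>k\<close>-open set around \<open>0\<close> contains all functions of some index \<open>m\<close>: otherwise one function
  outside for each index would give a sequence with a subsequence converging \<open>k\<close>-weakly to \<open>0\<close>
  inside the \<open>k\<close>-closed complement.
\<close>

lemma not_locally_convex_tau:
  fixes \<Phi> :: "('k::real_normed_field \<Rightarrow> real) set"
  assumes k: "k \<ge> 1" and \<Phi>: "norming \<Phi>"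
  shows "\<not> neighbourhood_base_of convex (tau (bcont_scale :: 'k \<Rightarrow> _ \<Rightarrow> (cantor \<Rightarrow>\<^sub>C 'k)) k)"
proof
  assume base: "neighbourhood_base_of convex (tau (bcont_scale :: 'k \<Rightarrow> _ \<Rightarrow> (cantor \<Rightarrow>\<^sub>C 'k)) k)"
  let ?W = "- (average k ` {1..}) :: (cantor \<Rightarrow>\<^sub>C 'k) set"
  have "average k n \<noteq> (0 :: cantor \<Rightarrow>\<^sub>C 'k)" if "n \<ge> 1" for n
  proof
    assume "average k n = (0 :: cantor \<Rightarrow>\<^sub>C 'k)"
    then have "apply_bcontfun (average k n) (\<lambda>m. m \<in> {n}) = (0 :: 'k)" by simp
    moreover have "1 / 2 \<le> weight k n (\<lambda>m. m \<in> {n})"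
      by (rule weight_ge_half[OF singleton_schreier[OF that]]) auto
    ultimately show False by (simp add: apply_average)
  qed
  then have "0 \<in> ?W" by force
  moreover have "openin (tau bcont_scale k) ?W"
    unfolding openin_tau k_open_def using k_closed_averages[OF \<Phi>] by simp
  ultimately have "\<exists>U V. openin (tau bcont_scale k) U \<and> convex V \<and> 0 \<in> U \<and> U \<subseteq> V \<and> V \<subseteq> ?W"
    by (intro base[unfolded neighbourhood_base_of, rule_format] conjI)
  then obtain U V :: "(cantor \<Rightarrow>\<^sub>C 'k) set" where
    U: "openin (tau bcont_scale k) U" "0 \<in> U" "U \<subseteq> V" and V: "convex V" "V \<subseteq> ?W"
    by (elim exE conjE)
  have "\<exists>m\<ge>1. \<forall>c\<in>colourings m. basic k m c \<in> U"
  proof (rule ccontr)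
    assume "\<not> ?thesis"
    then have "\<exists>c. c \<in> colourings (Suc i) \<and> basic k (Suc i) c \<notin> U" for i by auto
    then obtain c where c: "\<And>i. c i \<in> colourings (Suc i)" "\<And>i. basic k (Suc i) (c i) \<notin> U" by metis
    have Suc_mono: "strict_mono Suc" by (simp add: strict_mono_def)
    obtain r :: "nat \<Rightarrow> nat" where r: "strict_mono r" "coherent (Suc \<circ> r) (c \<circ> r)"
      using coherent_subsequence[OF Suc_mono, of c] c(1) by blast
    have conv: "k_weakly_converges bcont_scale k
        (\<lambda>i. basic k ((Suc \<circ> r) i) ((c \<circ> r) i) :: cantor \<Rightarrow>\<^sub>C 'k) 0"
      using coherent_basic_k_weakly_null[OF k strict_mono_o[OF Suc_mono r(1)] r(2)] .
    have closed: "k_closed bcont_scale k (- U)" using U(1) unfolding openin_tau k_open_def .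
    have "\<forall>i\<ge>1. basic k ((Suc \<circ> r) i) ((c \<circ> r) i) \<in> - U" using c(2) by simp
    then have "0 \<in> - U"
      using closed[unfolded k_closed_def, THEN spec, THEN spec, THEN mp, OF conjI, OF _ conv] by blast
    then show False using U(2) by simp
  qed
  then obtain m where m: "m \<ge> 1" "\<And>c. c \<in> colourings m \<Longrightarrow> basic k m c \<in> V" using U(3) by blast
  then have "average k m \<in> V" using V(1) by (intro average_in_convex)
  then show False using V(2) m(1) by blast
qed

lemma norming_real: "norming {\<lambda>z :: real. z, uminus}"
proof -
  have "(\<lambda>z :: real. z) \<noteq> uminus" by (metis one_neq_neg_one)
  moreover have "linear (\<lambda>z :: real. z)" "linear (uminus :: real \<Rightarrow> real)"
    by (auto intro: linearI)
  ultimately show ?thesis unfolding norming_def by auto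
qed

lemma norming_complex: "norming {Re, \<lambda>z. - Re z, Im, \<lambda>z. - Im z}"
proof -
  have "Re \<noteq> (\<lambda>z. - Re z)" "Re \<noteq> Im" "Re \<noteq> (\<lambda>z. - Im z)" "(\<lambda>z. - Re z) \<noteq> Im" "(\<lambda>z. - Re z) \<noteq> (\<lambda>z. - Im z)"
    by (auto dest!: fun_cong[of _ _ 1])
  moreover have "Im \<noteq> (\<lambda>z. - Im z)" by (auto dest!: fun_cong[of _ _ \<i>])
  ultimately have sum: "(\<Sum>\<phi>\<in>{Re, \<lambda>z. - Re z, Im, \<lambda>z. - Im z}. max 0 (\<phi> z))
      = max 0 (Re z) + (max 0 (- Re z) + (max 0 (Im z) + max 0 (- Im z)))" for z
    by simp
  have "linear Re" "linear (\<lambda>z. - Re z)" "linear Im" "linear (\<lambda>z. - Im z)"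
    by (auto intro: linearI)
  moreover have "Re z \<le> norm z" "- Re z \<le> norm z" "Im z \<le> norm z" "- Im z \<le> norm z" for z
    using abs_Re_le_cmod[of z] abs_Im_le_cmod[of z] by linarith+
  moreover have "norm z \<le> max 0 (Re z) + (max 0 (- Re z) + (max 0 (Im z) + max 0 (- Im z)))" for z
    using cmod_le[of z] by linarith
  ultimately show ?thesis unfolding norming_def sum by simp
qed

theorem corollary4p4:
  fixes k :: nat
  assumes "k \<ge> 1"
  shows "((\<exists>K :: (cantor \<Rightarrow>\<^sub>C real) set.
             k_weakly_compact bcont_scale k K \<and>
             \<not> k_weakly_compact bcont_scale k (closure (convex hull K))) \<and>
          \<not> neighbourhood_base_of convex
               (tau (bcont_scale :: real \<Rightarrow> _ \<Rightarrow> (cantor \<Rightarrow>\<^sub>C real)) k)) \<and>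
         ((\<exists>K :: (cantor \<Rightarrow>\<^sub>C complex) set.
             k_weakly_compact bcont_scale k K \<and>
             \<not> k_weakly_compact bcont_scale k (closure (convex hull K))) \<and>
          \<not> neighbourhood_base_of convex
               (tau (bcont_scale :: complex \<Rightarrow> _ \<Rightarrow> (cantor \<Rightarrow>\<^sub>C complex)) k))"
proof (intro conjI)
  show "\<exists>K :: (cantor \<Rightarrow>\<^sub>C real) set. k_weakly_compact bcont_scale k K \<and>
      \<not> k_weakly_compact bcont_scale k (closure (convex hull K))"
    using k_weakly_compact_basics[OF assms] closed_convex_hull_not_k_weakly_compact[OF norming_real]
    by (intro exI[of _ "basics k"] conjI)
  show "\<exists>K :: (cantor \<Rightarrow>\<^sub>C complex) set. k_weakly_compact bcont_scale k K \<and>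
      \<not> k_weakly_compact bcont_scale k (closure (convex hull K))"
    using k_weakly_compact_basics[OF assms] closed_convex_hull_not_k_weakly_compact[OF norming_complex]
    by (intro exI[of _ "basics k"] conjI)
qed (rule not_locally_convex_tau[OF assms norming_real] not_locally_convex_tau[OF assms norming_complex])+
end
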